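(* Consider the CFD-SQO$_1$-eq-free method of the context, applied to problem (Q), with parameters $\rho\in(0,0.5)$ and $\tau_1>1$, and let $\{u_k=(x_k,y_k)\}$ be an infinite sequence it generates. Suppose: (1) there is $\eta>0$ with $\mathcal H_k^u\succeq\eta I_{n_1+n_2}$ for all $k$, and whenever a subsequence $\{u_k\}_{k\in K}$ is bounded, $\{\mathcal H_k^u\}_{k\in K}$ is bounded; (2) $f$ and $\theta$ are twice continuously differentiable in a neighborhood of $\mathcal F_+$; the sequence $\{u_k\}$ is bounded, and every accumulation point $u_*=(x_*,y_* )$ of it satisfies: (a) the matrix $\mathcal B_{u_*}=\begin{pmatrix}E_{S_{u_*}}&F_{S_{u_*}}\\ C_{I_{x_*}}&0\\ 0&D_{J_{y_*}}\end{pmatrix}$ has full row rank; (b) with $(\mu_*,\alpha_*^x,\gamma_*^x,\alpha_*^y,\gamma_*^y)$ the unique KKT multiplier of (Q) at $u_*$, one has $z^\top\nabla^2\Phi(u_* )z>0$ for all $0\ne z\in\mathbb R^{n_1+n_2}$ with $\begin{pmatrix}E_{S_*^+}&F_{S_*^+}\\ C_{I_*^+}&0\\0&D_{J_*^+}\end{pmatrix}z=0$; (3) at least one of the following holds: either $\|(\mathcal H_k^u-\nabla^2\Phi(u_k))d_k^u\|=o(\|d_k^u\|)$; or $\|P_k(\mathcal H_k^u-\nabla^2\Phi(u_k))d_k^u\|=o(\|d_k^u\|)$ and strict complementarity holds: $(\alpha_*^x)_{I_*^l}>0$, $(\gamma_*^x)_{I_*^v}>0$, $(\alpha_*^y)_{J_*^s}>0$,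 $(\gamma_*^y)_{J_*^r}>0$, $(\mu_* )_{S_*}>0$. Then $\{u_k\}$ converges superlinearly to $u_*$, i.e. $\|u_{k+1}-u_*\|=o(\|u_k-u_*\|)$.
   Context: **Problem (Q)** (no equality constraint). Minimize $\Phi(u)=\Phi(x,y):=f(x)+\theta(y)$ subject to $Ex+Fy-d\le 0$, $x\in\mathcal X:=\{x\in\mathbb R^{n_1}: l\le Cx\le v\}$, $y\in\mathcal Y:=\{y\in\mathbb R^{n_2}: s\le Dy\le r\}$, where $E\in\mathbb R^{m_2\times n_1}$, $F\in\mathbb R^{m_2\times n_2}$, $d\in\mathbb R^{m_2}$, $C\in\mathbb R^{l_1\times n_1}$, $D\in\mathbb R^{l_2\times n_2}$; $l,s$ have entries in $\mathbb R\cup\{-\infty\}$, $v,r$ have entries in $\mathbb R\cup\{+\infty\}$, $l<v$, $s<r$ componentwise; $f,\theta$ are at least continuously differentiable. Write $u=(x,y)$, $\|z\|_H^2=z^\top Hz$, and $\mathcal F_+=\{(x,y)\in\mathcal X\times\mathcal Y:Ex+Fy-d\le0\}$ (the feasible set). The multiplier of an infinite bound is $0$ by convention; $0\le p\perp q\ge 0$ means $p,q\ge0$, $p^\top q=0$. KKT conditions of (Q) at $u\in\mathcal F_+$ with multiplier $(\mu,\alpha^x,\gamma^x,\alpha^y,\gamma^y)$: $\nabla f(x)+E^\top\mu+C^\top(\gamma^x-\alpha^x)=0$, $\nabla\theta(y)+F^\top\mu+D^\top(\gamma^y-\alpha^y)=0$, $0\le\mu\perp(d-Ex-Fy)\ge0$,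 $0\le\alpha^x\perp(Cx-l)\ge0$, $0\le\gamma^x\perp(v-Cx)\ge0$, $0\le\alpha^y\perp(Dy-s)\ge0$, $0\le\gamma^y\perp(r-Dy)\ge0$. **CFD-SQO$_1$-eq-free method.** (This is the paper's PFD-SQO method with parameter $c=1$ applied to (Q), all terms from equality constraints being absent.) Parameters: $\rho,\sigma\in(0,1)$, $\tau_1>0$, $M,M_1>0$. Start from $u_0\in\mathcal F_+$. At iteration $k$, given $u_k=(x_k,y_k)\in\mathcal F_+$ and symmetric positive definite $H_k^x\in\mathbb R^{n_1\times n_1}$, $H_k^y\in\mathbb R^{n_2\times n_2}$, put $h_k=Ex_k+Fy_k-d$ and $\mathcal H_k^u=\mathrm{diag}(H_k^x,H_k^y)$. Step 1. $\tilde x_{k+1}$ is the minimizer of $\nabla f(x_k)^\top(x-x_k)+\frac12\|x-x_k\|^2_{H_k^x}$ s.t. $Ex+Fy_k-d\le\frac12h_k$, $l\le Cx\le v$, with KKT multipliers $\mu_k^x,\alpha_k^x,\gamma_k^x$ for $Ex+Fy_k-d\le\frac12h_k$, $Cx\ge l$, $Cx\le v$; $\tilde y_{k+1}$ is the minimizer of $\nabla\theta(y_k)^\top(y-y_k)+\frac12\|y-y_k\|^2_{H_k^y}$ s.t. $Ex_k+Fy-d\le\frac12h_k$, $s\le Dy\le r$, with KKT multipliers $\mu_k^y,\alpha_k^y,\gamma_k^y$ for $Ex_k+Fy-d\le\frac12h_k$, $Dy\ge s$, $Dy\le r$. Step 2. $d_k^u=(\tilde x_{k+1}-x_k,\tilde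 y_{k+1}-y_k)$. If $\min\{\|\mu_k^x\|,\|\mu_k^y\|\}\le M$ and $\|\mu_k^x-\mu_k^y\|\le M_1\|d_k^u\|^{\tau_1}$, go to Step 4; otherwise go to Step 3. Step 3. $(\tilde x_{k+1},\tilde y_{k+1})$ is the minimizer of $\nabla f(x_k)^\top(x-x_k)+\frac12\|x-x_k\|^2_{H_k^x}+\nabla\theta(y_k)^\top(y-y_k)+\frac12\|y-y_k\|^2_{H_k^y}$ s.t. $Ex+Fy-d\le0$, $x\in\mathcal X$, $y\in\mathcal Y$, with multiplier $\mu_k$ for $Ex+Fy-d\le0$ and $\alpha_k^x,\gamma_k^x,\alpha_k^y,\gamma_k^y$ for the bounds; set $\mu_k^x=\mu_k^y=\mu_k$; redefine $d_k^u=(\tilde x_{k+1}-x_k,\tilde y_{k+1}-y_k)$. Step 4. $t_k$ is the largest $t\in\{\sigma^i:i=0,1,2,\dots\}$ with $\Phi(u_k+td_k^u)\le\Phi(u_k)-\rho t\|d_k^u\|^2_{\mathcal H_k^u}$. Step 5. $u_{k+1}=u_k+t_kd_k^u$. If $u_{k+1}=u_k$, stop; otherwise choose new symmetric positive definite $H_{k+1}^x,H_{k+1}^y$ and continue. **Active sets.** For $u=(x,y)\in\mathcal F_+$: $I_x^l=\{i:(Cx)_i=l_i\}$, $I_x^v=\{i:(Cx)_i=v_i\}$, $I_x=I_x^l\cup I_x^v$, $J_y^s=\{j:(Dy)_j=s_j\}$, $J_y^r=\{j:(Dy)_j=r_j\}$, $J_y=J_y^s\cup J_y^r$, $S_u=\{i:(Ex+Fy-d)_i=0\}$.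 $Q_S$ is the submatrix (subvector) of rows with indices in $S$. At $u_*$: $I_*^l=I_{x_*}^l$, $I_*^v=I_{x_*}^v$, $J_*^s=J_{y_*}^s$, $J_*^r=J_{y_*}^r$, $S_*=S_{u_*}$; $I_*^+=\{i\in I_*^l:(\alpha_*^x)_i>0\}\cup\{i\in I_*^v:(\gamma_*^x)_i>0\}$, $J_*^+=\{j\in J_*^s:(\alpha_*^y)_j>0\}\cup\{j\in J_*^r:(\gamma_*^y)_j>0\}$, $S_*^+=\{i\in S_*:(\mu_* )_i>0\}$. **Projection matrix.** $I_k=I_{\tilde x_{k+1}}$, $J_k=J_{\tilde y_{k+1}}$; $S_k^+=\{i:(E\tilde x_{k+1}+F\tilde y_{k+1}-d)_i=0\}$ if $(\tilde x_{k+1},\tilde y_{k+1})$ comes from Step 3, and $S_k^+=\{i:(E\tilde x_{k+1}+Fy_k-d-\frac12h_k)_i=0\}\cap\{i:(Ex_k+F\tilde y_{k+1}-d-\frac12h_k)_i=0\}$ if it comes from Step 1. $\mathcal B_k=\begin{pmatrix}E_{S_k^+}&F_{S_k^+}\\ C_{I_k}&0\\0&D_{J_k}\end{pmatrix}$ and $P_k=I_{n_1+n_2}-\mathcal B_k^\top(\mathcal B_k\mathcal B_k^\top)^{-1}\mathcal B_k$ (well defined for all sufficiently large $k$ under the hypotheses). *)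

theory Defs
  imports "HOL-Analysis.Analysis" "HOL-Library.Landau_Symbols" "HOL-Library.Extended_Real"
begin

section \<open>Vectors and matrices\<close>

text \<open>The space of all \<open>u = (x, y)\<close> is \<open>real ^ ('n + 'p)\<close>, so that its norm is the Euclidean one and
  matrices act on it directly.\<close>

definition stack :: "'a ^ 'n \<Rightarrow> 'a ^ 'p \<Rightarrow> 'a ^ ('n + 'p)" where
  "stack x y = (\<chi> i. case i of Inl a \<Rightarrow> x $ a | Inr b \<Rightarrow> y $ b)"

definition xpart :: "'a ^ ('n::finite + 'p::finite) \<Rightarrow> 'a ^ 'n" where
  "xpart u = (\<chi> a. u $ Inl a)"

definition ypart :: "'a ^ ('n::finite + 'p::finite) \<Rightarrow> 'a ^ 'p" where
  "ypart u = (\<chi> b. u $ Inr b)"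

definition diag_block :: "real ^ 'n ^ 'n \<Rightarrow> real ^ 'p ^ 'p \<Rightarrow> real ^ ('n + 'p) ^ ('n + 'p)" where
  "diag_block A B = (\<chi> i. case i of Inl a \<Rightarrow> stack (A $ a) 0 | Inr b \<Rightarrow> stack 0 (B $ b))"

definition sq_norm :: "real ^ 'n ^ 'n \<Rightarrow> real ^ 'n \<Rightarrow> real" where
  "sq_norm H z = z \<bullet> (H *v z)"

definition sym_pos_def :: "real ^ 'n ^ 'n \<Rightarrow> bool" where
  "sym_pos_def H \<longleftrightarrow> transpose H = H \<and> (\<forall>z. z \<noteq> 0 \<longrightarrow> 0 < sq_norm H z)"

definition pos_semidef :: "real ^ 'n ^ 'n \<Rightarrow> bool" where
  "pos_semidef H \<longleftrightarrow> transpose H = H \<and> (\<forall>z. 0 \<le> sq_norm H z)"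

text \<open>The submatrix of the rows with index in \<open>R\<close>. Its number of rows is not a type, so it is
  represented by a matrix of the original size whose other rows are zero. It has the same kernel and
  rank as the submatrix, and full row rank means that the rank is \<open>card R\<close>.\<close>

definition row_submatrix :: "'r set \<Rightarrow> real ^ 'c ^ 'r \<Rightarrow> real ^ 'c ^ 'r" where
  "row_submatrix R A = (\<chi> i. if i \<in> R then A $ i else 0)"

definition full_row_rank :: "'r::finite set \<Rightarrow> real ^ 'c ^ 'r \<Rightarrow> bool" where
  "full_row_rank R A \<longleftrightarrow> rank (row_submatrix R A) = card R"

text \<open>Square matrices with rows and columns indexed by \<open>R\<close> are likewise the matrices vanishing
  outside \<open>R \<times> R\<close>. Their identity is \<open>mat_one_on R\<close>, and \<open>matrix_inv_on R\<close> is inversion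
  among them, on the pattern of \<^const>\<open>matrix_inv\<close>.\<close>

definition mat_one_on :: "'r set \<Rightarrow> real ^ 'r ^ 'r" where
  "mat_one_on R = row_submatrix R (mat 1)"

definition matrix_inv_on :: "'r set \<Rightarrow> real ^ 'r ^ 'r \<Rightarrow> real ^ 'r ^ 'r" where
  "matrix_inv_on R G = (SOME N. (\<forall>i j. i \<notin> R \<or> j \<notin> R \<longrightarrow> N $ i $ j = 0) \<and>
     G ** N = mat_one_on R \<and> N ** G = mat_one_on R)"

text \<open>\<open>I - B\<^sup>T (B B\<^sup>T)\<^sup>-\<^sup>1 B\<close> for \<open>B\<close> the submatrix of the rows in \<open>R\<close>.\<close>

definition null_projection :: "'r::finite set \<Rightarrow> real ^ 'c ^ 'r \<Rightarrow> real ^ 'c ^ 'c" where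
  "null_projection R A = (let B = row_submatrix R A in
     mat 1 - transpose B ** matrix_inv_on R (B ** transpose B) ** B)"

section \<open>Derivatives and accumulation points\<close>

definition grad :: "(real ^ 'n \<Rightarrow> real) \<Rightarrow> real ^ 'n \<Rightarrow> real ^ 'n" where
  "grad g x = (THE D. GDERIV g x :> D)"

definition hessian :: "(real ^ 'n \<Rightarrow> real) \<Rightarrow> real ^ 'n \<Rightarrow> real ^ 'n ^ 'n" where
  "hessian g x = jacobian (grad g) (at x)"

definition C1_on :: "(real ^ 'n) set \<Rightarrow> (real ^ 'n \<Rightarrow> real) \<Rightarrow> bool" where
  "C1_on U g \<longleftrightarrow> (\<forall>x\<in>U. g differentiable (at x)) \<and> continuous_on U (grad g)"

definition C2_on :: "(real ^ 'n) set \<Rightarrow> (real ^ 'n \<Rightarrow> real) \<Rightarrow> bool" where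
  "C2_on U g \<longleftrightarrow> C1_on U g \<and> (\<forall>x\<in>U. grad g differentiable (at x)) \<and> continuous_on U (hessian g)"

definition accumulation_point :: "(nat \<Rightarrow> 'a::topological_space) \<Rightarrow> 'a \<Rightarrow> bool" where
  "accumulation_point u a \<longleftrightarrow> (\<exists>r. strict_mono r \<and> (u \<circ> r) \<longlonglongrightarrow> a)"

section \<open>The problem\<close>

record ('n::finite, 'p::finite, 'm::finite, 'a::finite, 'b::finite) problem =
  objF :: "real ^ 'n \<Rightarrow> real"
  objTheta :: "real ^ 'p \<Rightarrow> real"
  matE :: "real ^ 'n ^ 'm"
  matF :: "real ^ 'p ^ 'm"
  vecD :: "real ^ 'm"
  matC :: "real ^ 'n ^ 'a"
  matD :: "real ^ 'p ^ 'b"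
  bndl :: "ereal ^ 'a"
  bndv :: "ereal ^ 'a"
  bnds :: "ereal ^ 'b"
  bndr :: "ereal ^ 'b"

definition valid_problem :: "('n::finite, 'p::finite, 'm::finite, 'a::finite, 'b::finite) problem \<Rightarrow> bool" where
  "valid_problem Q \<longleftrightarrow>
     C1_on UNIV (objF Q) \<and> C1_on UNIV (objTheta Q) \<and>
     (\<forall>i. bndl Q $ i \<noteq> \<infinity> \<and> bndv Q $ i \<noteq> -\<infinity> \<and> bndl Q $ i < bndv Q $ i) \<and>
     (\<forall>j. bnds Q $ j \<noteq> \<infinity> \<and> bndr Q $ j \<noteq> -\<infinity> \<and> bnds Q $ j < bndr Q $ j)"

definition Phi :: "('n::finite, 'p::finite, 'm::finite, 'a::finite, 'b::finite) problem \<Rightarrow> real ^ ('n + 'p) \<Rightarrow> real" where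
  "Phi Q u = objF Q (xpart u) + objTheta Q (ypart u)"

definition residual :: "('n::finite, 'p::finite, 'm::finite, 'a::finite, 'b::finite) problem \<Rightarrow> real ^ 'n \<Rightarrow> real ^ 'p \<Rightarrow> real ^ 'm" where
  "residual Q x y = matE Q *v x + matF Q *v y - vecD Q"

definition setX :: "('n::finite, 'p::finite, 'm::finite, 'a::finite, 'b::finite) problem \<Rightarrow> (real ^ 'n) set" where
  "setX Q = {x. \<forall>i. bndl Q $ i \<le> ereal ((matC Q *v x) $ i) \<and> ereal ((matC Q *v x) $ i) \<le> bndv Q $ i}"

definition setY :: "('n::finite, 'p::finite, 'm::finite, 'a::finite, 'b::finite) problem \<Rightarrow> (real ^ 'p) set" where
  "setY Q = {y. \<forall>j. bnds Q $ j \<le> ereal ((matD Q *v y) $ j) \<and> ereal ((matD Q *v y) $ j) \<le> bndr Q $ j}"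

definition feasible :: "('n::finite, 'p::finite, 'm::finite, 'a::finite, 'b::finite) problem \<Rightarrow> (real ^ ('n + 'p)) set" where
  "feasible Q = {u. xpart u \<in> setX Q \<and> ypart u \<in> setY Q \<and> residual Q (xpart u) (ypart u) \<le> 0}"

text \<open>\<open>0 \<le> p \<perp> q \<ge> 0\<close>. The slack \<open>q\<close> may have infinite entries. As \<open>0 * \<infinity> = 0\<close> and
  \<open>c * \<infinity> = \<infinity>\<close> for \<open>c > 0\<close> in \<^typ>\<open>ereal\<close>, this makes the multiplier of an infinite bound zero.\<close>

definition complementary :: "real ^ 'k \<Rightarrow> ereal ^ 'k \<Rightarrow> bool" where
  "complementary p q \<longleftrightarrow> (\<forall>i. 0 \<le> p $ i) \<and> (\<forall>i. 0 \<le> q $ i) \<and> (\<Sum>i\<in>UNIV. ereal (p $ i) * q $ i) = 0"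

definition to_ereal :: "real ^ 'k \<Rightarrow> ereal ^ 'k" where
  "to_ereal p = (\<chi> i. ereal (p $ i))"

definition lower_slack :: "real ^ 'n ^ 'k \<Rightarrow> ereal ^ 'k \<Rightarrow> real ^ 'n \<Rightarrow> ereal ^ 'k" where
  "lower_slack C l x = (\<chi> i. ereal ((C *v x) $ i) - l $ i)"

definition upper_slack :: "real ^ 'n ^ 'k \<Rightarrow> ereal ^ 'k \<Rightarrow> real ^ 'n \<Rightarrow> ereal ^ 'k" where
  "upper_slack C v x = (\<chi> i. v $ i - ereal ((C *v x) $ i))"

text \<open>Stationarity and complementarity for one block of variables constrained by \<open>A x \<le> \<dots>\<close> (the
  complementarity of \<open>\<mu>\<close> is stated separately) and \<open>l \<le> C x \<le> v\<close>; \<open>g\<close> is the gradient of the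
  objective at \<open>x\<close>.\<close>

definition kkt_block ::
  "real ^ 'n \<Rightarrow> real ^ 'n ^ 'm \<Rightarrow> real ^ 'n ^ 'k \<Rightarrow> ereal ^ 'k \<Rightarrow> ereal ^ 'k \<Rightarrow> real ^ 'n \<Rightarrow>
   real ^ 'm \<Rightarrow> real ^ 'k \<Rightarrow> real ^ 'k \<Rightarrow> bool" where
  "kkt_block g A C l v x \<mu> \<alpha> \<gamma> \<longleftrightarrow>
     g + transpose A *v \<mu> + transpose C *v (\<gamma> - \<alpha>) = 0 \<and>
     complementary \<alpha> (lower_slack C l x) \<and> complementary \<gamma> (upper_slack C v x)"

definition kkt ::
  "('n::finite, 'p::finite, 'm::finite, 'a::finite, 'b::finite) problem \<Rightarrow> real ^ ('n + 'p) \<Rightarrow>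
   real ^ 'm \<Rightarrow> real ^ 'a \<Rightarrow> real ^ 'a \<Rightarrow> real ^ 'b \<Rightarrow> real ^ 'b \<Rightarrow> bool" where
  "kkt Q u \<mu> \<alpha>x \<gamma>x \<alpha>y \<gamma>y \<longleftrightarrow>
     kkt_block (grad (objF Q) (xpart u)) (matE Q) (matC Q) (bndl Q) (bndv Q) (xpart u) \<mu> \<alpha>x \<gamma>x \<and>
     kkt_block (grad (objTheta Q) (ypart u)) (matF Q) (matD Q) (bnds Q) (bndr Q) (ypart u) \<mu> \<alpha>y \<gamma>y \<and>
     complementary \<mu> (to_ereal (- residual Q (xpart u) (ypart u)))"

section \<open>Active sets\<close>

definition act_l :: "('n::finite, 'p::finite, 'm::finite, 'a::finite, 'b::finite) problem \<Rightarrow> real ^ 'n \<Rightarrow> 'a set" where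
  "act_l Q x = {i. ereal ((matC Q *v x) $ i) = bndl Q $ i}"

definition act_v :: "('n::finite, 'p::finite, 'm::finite, 'a::finite, 'b::finite) problem \<Rightarrow> real ^ 'n \<Rightarrow> 'a set" where
  "act_v Q x = {i. ereal ((matC Q *v x) $ i) = bndv Q $ i}"

definition act_s :: "('n::finite, 'p::finite, 'm::finite, 'a::finite, 'b::finite) problem \<Rightarrow> real ^ 'p \<Rightarrow> 'b set" where
  "act_s Q y = {j. ereal ((matD Q *v y) $ j) = bnds Q $ j}"

definition act_r :: "('n::finite, 'p::finite, 'm::finite, 'a::finite, 'b::finite) problem \<Rightarrow> real ^ 'p \<Rightarrow> 'b set" where
  "act_r Q y = {j. ereal ((matD Q *v y) $ j) = bndr Q $ j}"

definition act_S :: "('n::finite, 'p::finite, 'm::finite, 'a::finite, 'b::finite) problem \<Rightarrow> real ^ 'n \<Rightarrow> real ^ 'p \<Rightarrow> 'm set" where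
  "act_S Q x y = {i. residual Q x y $ i = 0}"

text \<open>All constraint rows, of which \<open>row_submatrix (S <+> (I <+> J))\<close> selects those in \<open>S\<close>, \<open>I\<close>
  and \<open>J\<close> of the three blocks.\<close>

definition constraint_matrix :: "('n::finite, 'p::finite, 'm::finite, 'a::finite, 'b::finite) problem \<Rightarrow> real ^ ('n + 'p) ^ ('m + ('a + 'b))" where
  "constraint_matrix Q = (\<chi> i. case i of
       Inl a \<Rightarrow> stack (matE Q $ a) (matF Q $ a)
     | Inr (Inl b) \<Rightarrow> stack (matC Q $ b) 0
     | Inr (Inr c) \<Rightarrow> stack 0 (matD Q $ c))"

definition licq :: "('n::finite, 'p::finite, 'm::finite, 'a::finite, 'b::finite) problem \<Rightarrow> real ^ ('n + 'p) \<Rightarrow> bool" where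
  "licq Q u \<longleftrightarrow> (let x = xpart u; y = ypart u in
     full_row_rank (act_S Q x y <+> ((act_l Q x \<union> act_v Q x) <+> (act_s Q y \<union> act_r Q y)))
       (constraint_matrix Q))"

definition strongly_active ::
  "('n::finite, 'p::finite, 'm::finite, 'a::finite, 'b::finite) problem \<Rightarrow> real ^ ('n + 'p) \<Rightarrow>
   real ^ 'm \<Rightarrow> real ^ 'a \<Rightarrow> real ^ 'a \<Rightarrow> real ^ 'b \<Rightarrow> real ^ 'b \<Rightarrow> ('m + ('a + 'b)) set" where
  "strongly_active Q u \<mu> \<alpha>x \<gamma>x \<alpha>y \<gamma>y = (let x = xpart u; y = ypart u in
     {i \<in> act_S Q x y. \<mu> $ i > 0} <+>
     (({i \<in> act_l Q x. \<alpha>x $ i > 0} \<union> {i \<in> act_v Q x. \<gamma>x $ i > 0}) <+>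
      ({j \<in> act_s Q y. \<alpha>y $ j > 0} \<union> {j \<in> act_r Q y. \<gamma>y $ j > 0})))"

definition strong_sosc ::
  "('n::finite, 'p::finite, 'm::finite, 'a::finite, 'b::finite) problem \<Rightarrow> real ^ ('n + 'p) \<Rightarrow>
   real ^ 'm \<Rightarrow> real ^ 'a \<Rightarrow> real ^ 'a \<Rightarrow> real ^ 'b \<Rightarrow> real ^ 'b \<Rightarrow> bool" where
  "strong_sosc Q u \<mu> \<alpha>x \<gamma>x \<alpha>y \<gamma>y \<longleftrightarrow>
     (\<forall>z. z \<noteq> 0 \<and>
        row_submatrix (strongly_active Q u \<mu> \<alpha>x \<gamma>x \<alpha>y \<gamma>y) (constraint_matrix Q) *v z = 0 \<longrightarrow>
        sq_norm (hessian (Phi Q) u) z > 0)"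

definition strict_complementarity ::
  "('n::finite, 'p::finite, 'm::finite, 'a::finite, 'b::finite) problem \<Rightarrow> real ^ ('n + 'p) \<Rightarrow>
   real ^ 'm \<Rightarrow> real ^ 'a \<Rightarrow> real ^ 'a \<Rightarrow> real ^ 'b \<Rightarrow> real ^ 'b \<Rightarrow> bool" where
  "strict_complementarity Q u \<mu> \<alpha>x \<gamma>x \<alpha>y \<gamma>y \<longleftrightarrow> (let x = xpart u; y = ypart u in
     (\<forall>i\<in>act_l Q x. \<alpha>x $ i > 0) \<and> (\<forall>i\<in>act_v Q x. \<gamma>x $ i > 0) \<and>
     (\<forall>j\<in>act_s Q y. \<alpha>y $ j > 0) \<and> (\<forall>j\<in>act_r Q y. \<gamma>y $ j > 0) \<and>
     (\<forall>i\<in>act_S Q x y. \<mu> $ i > 0))"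

section \<open>The method\<close>

text \<open>The trial point \<open>(\<tilde>x, \<tilde>y)\<close> with its multipliers, as computed in Step 1 or Step 3.\<close>

record ('n::finite, 'p::finite, 'm::finite, 'a::finite, 'b::finite) trial =
  trX :: "real ^ 'n"
  trY :: "real ^ 'p"
  muX :: "real ^ 'm"
  muY :: "real ^ 'm"
  alphaX :: "real ^ 'a"
  gammaX :: "real ^ 'a"
  alphaY :: "real ^ 'b"
  gammaY :: "real ^ 'b"

definition model :: "(real ^ 'n \<Rightarrow> real) \<Rightarrow> real ^ 'n ^ 'n \<Rightarrow> real ^ 'n \<Rightarrow> real ^ 'n \<Rightarrow> real" where
  "model g H x0 x = grad g x0 \<bullet> (x - x0) + (1/2) * sq_norm H (x - x0)"

definition model_grad :: "(real ^ 'n \<Rightarrow> real) \<Rightarrow> real ^ 'n ^ 'n \<Rightarrow> real ^ 'n \<Rightarrow> real ^ 'n \<Rightarrow> real ^ 'n" where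
  "model_grad g H x0 x = grad g x0 + H *v (x - x0)"

definition step1 ::
  "('n::finite, 'p::finite, 'm::finite, 'a::finite, 'b::finite) problem \<Rightarrow> real ^ ('n + 'p) \<Rightarrow> real ^ 'n ^ 'n \<Rightarrow> real ^ 'p ^ 'p \<Rightarrow>
   ('n, 'p, 'm, 'a, 'b) trial \<Rightarrow> bool" where
  "step1 Q u Hx Hy w \<longleftrightarrow> (let x = xpart u; y = ypart u; h = residual Q x y in
     is_arg_min (model (objF Q) Hx x) (\<lambda>x'. residual Q x' y \<le> (1/2) *\<^sub>R h \<and> x' \<in> setX Q) (trX w) \<and>
     kkt_block (model_grad (objF Q) Hx x (trX w)) (matE Q) (matC Q) (bndl Q) (bndv Q) (trX w)
       (muX w) (alphaX w) (gammaX w) \<and>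
     complementary (muX w) (to_ereal ((1/2) *\<^sub>R h - residual Q (trX w) y)) \<and>
     is_arg_min (model (objTheta Q) Hy y) (\<lambda>y'. residual Q x y' \<le> (1/2) *\<^sub>R h \<and> y' \<in> setY Q) (trY w) \<and>
     kkt_block (model_grad (objTheta Q) Hy y (trY w)) (matF Q) (matD Q) (bnds Q) (bndr Q) (trY w)
       (muY w) (alphaY w) (gammaY w) \<and>
     complementary (muY w) (to_ereal ((1/2) *\<^sub>R h - residual Q x (trY w))))"

definition direction ::
  "real ^ ('n::finite + 'p::finite) \<Rightarrow> ('n, 'p, 'm::finite, 'a::finite, 'b::finite) trial \<Rightarrow> real ^ ('n + 'p)" where
  "direction u w = stack (trX w) (trY w) - u"

definition step2_accepts ::
  "real \<Rightarrow> real \<Rightarrow> real \<Rightarrow> real ^ ('n + 'p) \<Rightarrow> ('n::finite, 'p::finite, 'm::finite, 'a::finite, 'b::finite) trial \<Rightarrow> bool" where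
  "step2_accepts M M1 \<tau>1 u w \<longleftrightarrow>
     min (norm (muX w)) (norm (muY w)) \<le> M \<and>
     norm (muX w - muY w) \<le> M1 * norm (direction u w) powr \<tau>1"

definition step3 ::
  "('n::finite, 'p::finite, 'm::finite, 'a::finite, 'b::finite) problem \<Rightarrow> real ^ ('n + 'p) \<Rightarrow> real ^ 'n ^ 'n \<Rightarrow> real ^ 'p ^ 'p \<Rightarrow>
   ('n, 'p, 'm, 'a, 'b) trial \<Rightarrow> bool" where
  "step3 Q u Hx Hy w \<longleftrightarrow> (let x = xpart u; y = ypart u in
     is_arg_min (\<lambda>(x', y'). model (objF Q) Hx x x' + model (objTheta Q) Hy y y')
       (\<lambda>(x', y'). residual Q x' y' \<le> 0 \<and> x' \<in> setX Q \<and> y' \<in> setY Q) (trX w, trY w) \<and>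
     muX w = muY w \<and>
     kkt_block (model_grad (objF Q) Hx x (trX w)) (matE Q) (matC Q) (bndl Q) (bndv Q) (trX w)
       (muX w) (alphaX w) (gammaX w) \<and>
     kkt_block (model_grad (objTheta Q) Hy y (trY w)) (matF Q) (matD Q) (bnds Q) (bndr Q) (trY w)
       (muY w) (alphaY w) (gammaY w) \<and>
     complementary (muX w) (to_ereal (- residual Q (trX w) (trY w))))"

definition line_search ::
  "('n::finite, 'p::finite, 'm::finite, 'a::finite, 'b::finite) problem \<Rightarrow> real \<Rightarrow> real \<Rightarrow> real ^ ('n + 'p) ^ ('n + 'p) \<Rightarrow>
   real ^ ('n + 'p) \<Rightarrow> real ^ ('n + 'p) \<Rightarrow> real \<Rightarrow> bool" where
  "line_search Q \<rho> \<sigma> H u d t \<longleftrightarrow>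
     (let T = {\<tau>. (\<exists>i::nat. \<tau> = \<sigma> ^ i) \<and> Phi Q (u + \<tau> *\<^sub>R d) \<le> Phi Q u - \<rho> * \<tau> * sq_norm H d}
      in t \<in> T \<and> (\<forall>\<tau>\<in>T. \<tau> \<le> t))"

text \<open>An infinite run. The trial point of Step 1 of iteration \<open>k\<close> is \<open>w1 k\<close>, and the one used in the
  line search is \<open>w k\<close>. Being infinite, the run never meets the stopping test \<open>u (k + 1) = u k\<close>.\<close>

definition infinite_run ::
  "('n::finite, 'p::finite, 'm::finite, 'a::finite, 'b::finite) problem \<Rightarrow> real \<Rightarrow> real \<Rightarrow> real \<Rightarrow> real \<Rightarrow> real \<Rightarrow>
   (nat \<Rightarrow> real ^ ('n + 'p)) \<Rightarrow> (nat \<Rightarrow> real ^ 'n ^ 'n) \<Rightarrow> (nat \<Rightarrow> real ^ 'p ^ 'p) \<Rightarrow>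
   (nat \<Rightarrow> ('n, 'p, 'm, 'a, 'b) trial) \<Rightarrow> (nat \<Rightarrow> ('n, 'p, 'm, 'a, 'b) trial) \<Rightarrow>
   (nat \<Rightarrow> real) \<Rightarrow> bool" where
  "infinite_run Q \<rho> \<sigma> \<tau>1 M M1 u Hx Hy w1 w t \<longleftrightarrow>
     u 0 \<in> feasible Q \<and>
     (\<forall>k. sym_pos_def (Hx k) \<and> sym_pos_def (Hy k) \<and>
          step1 Q (u k) (Hx k) (Hy k) (w1 k) \<and>
          (if step2_accepts M M1 \<tau>1 (u k) (w1 k) then w k = w1 k
           else step3 Q (u k) (Hx k) (Hy k) (w k)) \<and>
          line_search Q \<rho> \<sigma> (diag_block (Hx k) (Hy k)) (u k) (direction (u k) (w k)) (t k) \<and>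
          u (Suc k) = u k + t k *\<^sub>R direction (u k) (w k) \<and>
          u (Suc k) \<noteq> u k)"

text \<open>The matrix \<open>P\<^sub>k\<close>; the first argument tells whether the trial point \<open>w\<close> comes from Step 1.\<close>

definition projection_matrix ::
  "bool \<Rightarrow> ('n::finite, 'p::finite, 'm::finite, 'a::finite, 'b::finite) problem \<Rightarrow> real ^ ('n + 'p) \<Rightarrow> ('n, 'p, 'm, 'a, 'b) trial \<Rightarrow>
   real ^ ('n + 'p) ^ ('n + 'p)" where
  "projection_matrix from_step1 Q u w =
     (let x = xpart u; y = ypart u; h = residual Q x y;
          S = (if from_step1
               then {i. (residual Q (trX w) y - (1/2) *\<^sub>R h) $ i = 0} \<inter>
                    {i. (residual Q x (trY w) - (1/2) *\<^sub>R h) $ i = 0}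
               else act_S Q (trX w) (trY w));
          I = act_l Q (trX w) \<union> act_v Q (trX w);
          J = act_s Q (trY w) \<union> act_r Q (trY w)
      in null_projection (S <+> (I <+> J)) (constraint_matrix Q))"

end

(* Every trial point is, up to an error O(|d|^tau1) = o(|d|) in stationarity, the solution of one quadratic
   program over the feasible polyhedron, with exact complementarity at the trial point. The line search forces
   d_k -> 0, and LICQ makes the multipliers converge along any convergent subsequence, so that accumulation
   points a are KKT points.

   Let z = u_k + d_k - a. Subtracting the KKT conditions at a from those at the trial point, pairing with z and
   using that complementarity makes the multiplier term monotone gives
   z . Hess z <= o(|z| (|z| + |d_k|)), while z is orthogonal to the strongly active rows. The strong second-order
   condition then yields |z| = o(|u_k - a|). The projected Hessian condition suffices here because the rows
   of P_k annihilate z. A Taylor expansion with rho < 1/2 shows that unit steps are eventually accepted. *)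

theory Submission
  imports Defs
begin

text \<open>The obstacle is Step 1, whose two multipliers of the coupling constraint differ. An
  error of size o(|d_k|) is harmless in stationarity, because pairing with z multiplies it by |z|.
  In complementarity it would stand alone and give only |z|^2 = o(|d_k|), which is not superlinear.
  The whole discrepancy therefore has to be moved into stationarity. This works because the two
  half-step constraints add up to the coupling constraint: the smaller multiplier in each component
  is still exactly complementary at the trial point, and the acceptance test bounds the stationarity
  error it causes. Convergence of the whole sequence is not assumed. The error estimate is thus
  stated along any indices that tend to infinity and whose iterates tend to \<open>a\<close>, and
  convergence is deduced from it. The Hessian error is tested twice, against z for the rate and
  against d_k for the unit step. The rows of P_k need not annihilate d_k, and it is in this second
  test that strict complementarity controls them.\<close>

lemma norm_matrix_vector_mult_le:
  fixes M :: "real ^ 'c ^ 'r"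
  shows "norm (M *v x) \<le> norm M * norm x"
proof -
  have "norm (M *v x) = L2_set (\<lambda>i. norm ((M *v x) $ i)) UNIV"
    by (simp add: norm_vec_def)
  also have "\<dots> \<le> L2_set (\<lambda>i. norm (M $ i) * norm x) UNIV"
    by (intro L2_set_mono) (auto simp: matrix_vector_mul_component Cauchy_Schwarz_ineq2)
  also have "\<dots> = norm M * norm x"
    by (simp add: norm_vec_def L2_set_left_distrib)
  finally show ?thesis .
qed

lemma continuous_matrix_vector_mult:
  fixes A :: "real ^ 'c ^ 'r"
  shows "continuous_on S (\<lambda>x. A *v x)"
  by (intro linear_continuous_on matrix_vector_mul_bounded_linear)

lemma tendsto_matrix_vector_mult:
  fixes A :: "real ^ 'c ^ 'r"
  assumes "(f \<longlongrightarrow> l) F"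
  shows "((\<lambda>x. A *v f x) \<longlongrightarrow> A *v l) F"
  using bounded_linear.tendsto[OF matrix_vector_mul_bounded_linear assms] .

lemma inner_transpose_vector:
  fixes A :: "real ^ 'c ^ 'r"
  shows "x \<bullet> (transpose A *v y) = (A *v x) \<bullet> y"
  by (metis dot_lmul_matrix inner_commute transpose_matrix_vector)

lemma inner_transpose_sum:
  fixes A :: "real ^ 'c ^ 'r"
  shows "x \<bullet> (transpose A *v y) = (\<Sum>i\<in>UNIV. y $ i * (A *v x) $ i)"
  unfolding inner_transpose_vector by (simp add: inner_vec_def mult.commute)

section \<open>Strict differentiability and second-order expansion\<close>

text \<open>The mean value inequality is applied to \<open>g\<close> minus its linearization at
  \<open>a\<close>, whose derivative \<open>Hs z - Hs a\<close> is small near \<open>a\<close>. The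
  bound is uniform in both points, as needed for comparing an iterate with its trial point when
  neither is \<open>a\<close>.\<close>

lemma strict_derivative:
  fixes g :: "real ^ 'c \<Rightarrow> real ^ 'c"
  assumes "open W" "a \<in> W" "0 < \<epsilon>"
    and deriv: "\<And>x. x \<in> W \<Longrightarrow> (g has_derivative (\<lambda>h. Hs x *v h)) (at x)"
    and cont: "continuous_on W Hs"
  obtains \<delta> where "0 < \<delta>"
    "\<And>x y. x \<in> ball a \<delta> \<Longrightarrow> y \<in> ball a \<delta> \<Longrightarrow>
       norm (g y - g x - Hs a *v (y - x)) \<le> \<epsilon> * norm (y - x)"
    "\<And>x. x \<in> ball a \<delta> \<Longrightarrow> norm (Hs x - Hs a) \<le> \<epsilon>"
proof -
  obtain \<delta>1 where d1: "0 < \<delta>1" "\<And>x. x \<in> W \<Longrightarrow> dist x a < \<delta>1 \<Longrightarrow> dist (Hs x) (Hs a) < \<epsilon>"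
    using cont assms(2,3) unfolding continuous_on_iff by meson
  obtain \<delta>2 where d2: "0 < \<delta>2" "ball a \<delta>2 \<subseteq> W"
    using assms(1,2) open_contains_ball by blast
  define \<delta> where "\<delta> = min \<delta>1 \<delta>2"
  have near: "norm (Hs x - Hs a) \<le> \<epsilon>" and inW: "x \<in> W" if "x \<in> ball a \<delta>" for x
    using that d1(2)[of x] d2 by (auto simp: \<delta>_def dist_norm norm_minus_commute less_imp_le)
  have "norm (g y - g x - Hs a *v (y - x)) \<le> \<epsilon> * norm (y - x)"
    if xy: "x \<in> ball a \<delta>" "y \<in> ball a \<delta>" for x y
  proof -
    have "norm ((g y - Hs a *v y) - (g x - Hs a *v x)) \<le> \<epsilon> * norm (y - x)"
    proof (rule differentiable_bound[OF convex_ball])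
      fix z assume z: "z \<in> ball a \<delta>"
      show "((\<lambda>x. g x - Hs a *v x) has_derivative (\<lambda>h. Hs z *v h - Hs a *v h)) (at z within ball a \<delta>)"
        by (intro has_derivative_diff has_derivative_at_withinI[OF deriv[OF inW[OF z]]]
            bounded_linear_imp_has_derivative matrix_vector_mul_bounded_linear)
      show "onorm (\<lambda>h. Hs z *v h - Hs a *v h) \<le> \<epsilon>"
      proof (rule onorm_bound)
        fix h
        have "norm (Hs z *v h - Hs a *v h) \<le> norm (Hs z - Hs a) * norm h"
          by (metis matrix_vector_mult_diff_rdistrib norm_matrix_vector_mult_le)
        also have "\<dots> \<le> \<epsilon> * norm h" using near[OF z] by (intro mult_right_mono) auto
        finally show "norm (Hs z *v h - Hs a *v h) \<le> \<epsilon> * norm h" .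
      qed (use \<open>0 < \<epsilon>\<close> in auto)
    qed (use xy in auto)
    then show ?thesis by (simp add: algebra_simps matrix_vector_mult_diff_distrib)
  qed
  with near d1 d2 show thesis using that[of \<delta>] by (auto simp: \<delta>_def)
qed

lemma has_real_derivative_along_line:
  fixes \<Phi> :: "real ^ 'c \<Rightarrow> real"
  assumes "\<And>x. (\<Phi> has_derivative (\<lambda>h. g x \<bullet> h)) (at x)"
  shows "((\<lambda>s. \<Phi> (x + s *\<^sub>R h)) has_real_derivative g (x + s *\<^sub>R h) \<bullet> h) (at s within S)"
proof -
  have "((\<lambda>s. x + s *\<^sub>R h) has_derivative (\<lambda>r. r *\<^sub>R h)) (at s within S)"
    by (auto intro!: derivative_eq_intros)
  from has_derivative_compose[OF this assms]
  have "((\<lambda>s. \<Phi> (x + s *\<^sub>R h)) has_derivative (\<lambda>r. g (x + s *\<^sub>R h) \<bullet> (r *\<^sub>R h))) (at s within S)" .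
  then show ?thesis
    by (simp add: has_field_derivative_def mult_commute_abs)
qed

text \<open>After subtraction of the quadratic model, the derivative along the segment is exactly
  the remainder in \<open>strict\<close> paired with \<open>h\<close>, so one use of the mean value
  theorem suffices.\<close>

lemma second_order_expansion:
  fixes \<Phi> :: "real ^ 'c \<Rightarrow> real" and G :: "real ^ 'c ^ 'c"
  assumes deriv: "\<And>x. (\<Phi> has_derivative (\<lambda>h. g x \<bullet> h)) (at x)"
    and strict: "\<And>x y. x \<in> ball a \<delta> \<Longrightarrow> y \<in> ball a \<delta> \<Longrightarrow>
       norm (g y - g x - G *v (y - x)) \<le> \<epsilon> * norm (y - x)"
    and x: "x \<in> ball a \<delta>" "x + h \<in> ball a \<delta>" and "0 \<le> \<epsilon>"
  shows "\<Phi> (x + h) - \<Phi> x \<le> g x \<bullet> h + (1/2) * (h \<bullet> (G *v h)) + \<epsilon> * (norm h)\<^sup>2"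
proof -
  define F where "F s = \<Phi> (x + s *\<^sub>R h) - s * (g x \<bullet> h) - (1/2) * s\<^sup>2 * (h \<bullet> (G *v h))" for s
  have D: "DERIV F s :> g (x + s *\<^sub>R h) \<bullet> h - g x \<bullet> h - s * (h \<bullet> (G *v h))" for s
    unfolding F_def
    by (rule derivative_eq_intros has_real_derivative_along_line[OF deriv] refl)+ simp
  obtain s where s: "0 < s" "s < 1"
    "F 1 - F 0 = (1 - 0) * (g (x + s *\<^sub>R h) \<bullet> h - g x \<bullet> h - s * (h \<bullet> (G *v h)))"
    using MVT2[of 0 1 F, OF _ D] by auto
  have "x + s *\<^sub>R h = (1 - s) *\<^sub>R x + s *\<^sub>R (x + h)" by (simp add: algebra_simps)
  then have mem: "x + s *\<^sub>R h \<in> ball a \<delta>"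
    using convexD[OF convex_ball x, of "1 - s" s] s by simp
  have "g (x + s *\<^sub>R h) \<bullet> h - g x \<bullet> h - s * (h \<bullet> (G *v h)) =
      (g (x + s *\<^sub>R h) - g x - G *v (x + s *\<^sub>R h - x)) \<bullet> h"
    by (simp add: inner_diff_left matrix_vector_mult_scaleR inner_commute[of h])
  also have "\<dots> \<le> norm (g (x + s *\<^sub>R h) - g x - G *v (x + s *\<^sub>R h - x)) * norm h"
    by (rule norm_cauchy_schwarz)
  also have "\<dots> \<le> \<epsilon> * norm (x + s *\<^sub>R h - x) * norm h"
    by (intro mult_right_mono strict x mem) auto
  also have "\<dots> = \<epsilon> * s * (norm h)\<^sup>2" using s by (simp add: power2_eq_square)
  also have "\<dots> \<le> \<epsilon> * (norm h)\<^sup>2"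
    using s \<open>0 \<le> \<epsilon>\<close> by (intro mult_right_mono) (auto intro: mult_left_le)
  finally have "F 1 - F 0 \<le> \<epsilon> * (norm h)\<^sup>2" using s(3) by simp
  then show ?thesis by (simp add: F_def)
qed

section \<open>Polyhedra given by two-sided bounds\<close>

text \<open>Extended real bounds let the coupling rows, bounded only above, and the two-sided rows
  form one constraint system.\<close>

definition box_polyhedron :: "real ^ 'c ^ 'r \<Rightarrow> ereal ^ 'r \<Rightarrow> ereal ^ 'r \<Rightarrow> (real ^ 'c) set" where
  "box_polyhedron A L U = {x. \<forall>i. L $ i \<le> ereal ((A *v x) $ i) \<and> ereal ((A *v x) $ i) \<le> U $ i}"

definition active_rows :: "real ^ 'c ^ 'r \<Rightarrow> ereal ^ 'r \<Rightarrow> ereal ^ 'r \<Rightarrow> real ^ 'c \<Rightarrow> 'r set" where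
  "active_rows A L U x = {i. ereal ((A *v x) $ i) = L $ i \<or> ereal ((A *v x) $ i) = U $ i}"

text \<open>One signed multiplier per row: its positive part belongs to the upper bound, its negative part to the
  lower bound. The bounds of a row differ, so the two are never active together.\<close>

definition sign_complementary ::
  "real ^ 'c ^ 'r \<Rightarrow> ereal ^ 'r \<Rightarrow> ereal ^ 'r \<Rightarrow> real ^ 'c \<Rightarrow> real ^ 'r \<Rightarrow> bool" where
  "sign_complementary A L U x \<nu> \<longleftrightarrow>
     (\<forall>i. (0 < \<nu> $ i \<longrightarrow> ereal ((A *v x) $ i) = U $ i) \<and> (\<nu> $ i < 0 \<longrightarrow> ereal ((A *v x) $ i) = L $ i))"

lemma closed_box_polyhedron: "closed (box_polyhedron A L U)"
  unfolding box_polyhedron_def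
  by (intro closed_Collect_all closed_Collect_conj closed_Collect_le continuous_on_const
      continuous_on_ereal continuous_on_component continuous_matrix_vector_mult)

lemma convex_combination_box_polyhedron:
  assumes x: "x \<in> box_polyhedron A L U" "x + h \<in> box_polyhedron A L U" and s: "0 \<le> s" "s \<le> 1"
  shows "x + s *\<^sub>R h \<in> box_polyhedron A L U"
proof -
  have "L $ i \<le> ereal ((A *v (x + s *\<^sub>R h)) $ i) \<and> ereal ((A *v (x + s *\<^sub>R h)) $ i) \<le> U $ i" for i
  proof -
    let ?p = "(A *v x) $ i" and ?q = "(A *v (x + h)) $ i"
    have e: "(A *v (x + s *\<^sub>R h)) $ i = ?p + s * (?q - ?p)"
      by (simp add: matrix_vector_right_distrib matrix_vector_mult_scaleR)
    have "min ?p ?q \<le> ?p + s * (?q - ?p)" "?p + s * (?q - ?p) \<le> max ?p ?q"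
      using convex_bound_le[of ?p "max ?p ?q" ?q "1 - s" s]
        convex_bound_le[of "- ?p" "- min ?p ?q" "- ?q" "1 - s" s] s
      by (auto simp: algebra_simps)
    moreover have "L $ i \<le> ereal (min ?p ?q)" "ereal (max ?p ?q) \<le> U $ i"
      using x by (auto simp: box_polyhedron_def min_def max_def)
    ultimately show ?thesis unfolding e by (meson ereal_less_eq(3) order_trans)
  qed
  then show ?thesis by (simp add: box_polyhedron_def)
qed

text \<open>The sign of \<open>\<nu> $ i\<close> names a bound attained at \<open>x\<close> and
  respected by \<open>y\<close>. In effect \<open>transpose A *v \<nu>\<close> is an outward normal
  of the polyhedron at \<open>x\<close>; applying this crosswise to two points makes the multiplier
  term monotone.\<close>

lemma sign_complementary_mono:
  assumes "sign_complementary A L U x \<nu>" "y \<in> box_polyhedron A L U"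
  shows "\<nu> $ i * (A *v y) $ i \<le> \<nu> $ i * (A *v x) $ i"
proof -
  have "L $ i \<le> ereal ((A *v y) $ i)" "ereal ((A *v y) $ i) \<le> U $ i"
    "0 < \<nu> $ i \<Longrightarrow> U $ i = ereal ((A *v x) $ i)" "\<nu> $ i < 0 \<Longrightarrow> L $ i = ereal ((A *v x) $ i)"
    using assms by (auto simp: box_polyhedron_def sign_complementary_def)
  then show ?thesis
    by (cases "\<nu> $ i" "0::real" rule: linorder_cases) (auto simp: mult_left_mono mult_left_mono_neg)
qed

lemma sign_complementary_active:
  assumes "sign_complementary A L U x \<nu>" "\<nu> $ i \<noteq> 0"
  shows "i \<in> active_rows A L U x"
  using assms by (cases "\<nu> $ i" "0::real" rule: linorder_cases)
    (auto simp: sign_complementary_def active_rows_def)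

text \<open>Missing a bound at the limit is an open condition, and there are finitely many rows. The
  two bounds are kept apart so that the attained value can be identified later.\<close>

lemma eventually_active_at_limit:
  assumes "(x \<longlongrightarrow> a) F"
  shows "\<forall>\<^sub>F j in F. \<forall>i. (ereal ((A *v x j) $ i) = L $ i \<longrightarrow> ereal ((A *v a) $ i) = L $ i) \<and>
      (ereal ((A *v x j) $ i) = U $ i \<longrightarrow> ereal ((A *v a) $ i) = U $ i)"
proof (rule eventually_all_finite)
  fix i
  have lim: "((\<lambda>j. ereal ((A *v x j) $ i)) \<longlongrightarrow> ereal ((A *v a) $ i)) F"
    by (intro tendsto_intros tendsto_matrix_vector_mult assms)
  have "\<forall>\<^sub>F j in F. ereal ((A *v x j) $ i) = c \<longrightarrow> ereal ((A *v a) $ i) = c" for c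
  proof (cases "ereal ((A *v a) $ i) = c")
    case False
    with tendsto_imp_eventually_ne[OF lim this] show ?thesis
      by (auto elim: eventually_mono)
  qed auto
  then show "\<forall>\<^sub>F j in F. (ereal ((A *v x j) $ i) = L $ i \<longrightarrow> ereal ((A *v a) $ i) = L $ i) \<and>
      (ereal ((A *v x j) $ i) = U $ i \<longrightarrow> ereal ((A *v a) $ i) = U $ i)"
    by (intro eventually_conj)
qed

section \<open>Superlinear convergence of perturbed SQP iterations\<close>

lemma infinite_not_eventually:
  assumes "\<not> eventually P sequentially"
  shows "infinite {n. \<not> P n}"
  using assms by (simp add: eventually_cofinite flip: cofinite_eq_sequentially)

text \<open>The set \<open>R k\<close> lets one bound cover both forms of the Hessian condition: it is empty if the
  approximation is good in all directions, and consists of the rows of \<open>P\<^sub>k\<close> if it is good only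
  after projection.\<close>

locale perturbed_sqp_run =
  fixes \<Phi> :: "real ^ 'c \<Rightarrow> real" and g :: "real ^ 'c \<Rightarrow> real ^ 'c" and Hs :: "real ^ 'c \<Rightarrow> real ^ 'c ^ 'c"
    and W :: "(real ^ 'c) set"
    and A :: "real ^ 'c ^ 'r" and L U :: "ereal ^ 'r"
    and \<rho> \<sigma> \<eta> C \<tau> K :: real
    and u d :: "nat \<Rightarrow> real ^ 'c" and H :: "nat \<Rightarrow> real ^ 'c ^ 'c"
    and \<nu> :: "nat \<Rightarrow> real ^ 'r" and t :: "nat \<Rightarrow> real" and R :: "nat \<Rightarrow> 'r set"
  assumes deriv: "\<And>x. (\<Phi> has_derivative (\<lambda>h. g x \<bullet> h)) (at x)"
    and g_cont: "continuous_on UNIV g"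
    and W: "open W" "box_polyhedron A L U \<subseteq> W"
    and deriv2: "\<And>x. x \<in> W \<Longrightarrow> (g has_derivative (\<lambda>h. Hs x *v h)) (at x)"
    and Hs_cont: "continuous_on W Hs"
    and params: "0 < \<rho>" "\<rho> < 1/2" "0 < \<sigma>" "\<sigma> < 1" "0 < \<eta>" "1 < \<tau>"
    and u_feasible: "\<And>k. u k \<in> box_polyhedron A L U"
    and trial_feasible: "\<And>k. u k + d k \<in> box_polyhedron A L U"
    and u_bounded: "bounded (range u)"
    and H_bounded: "bounded (range H)"
    and H_coercive: "\<And>k z. \<eta> * (norm z)\<^sup>2 \<le> z \<bullet> (H k *v z)"
    and complementary: "\<And>k. sign_complementary A L U (u k + d k) (\<nu> k)"
    and stationary: "\<And>k. norm (g (u k) + H k *v d k + transpose A *v \<nu> k) \<le> C * norm (d k) powr \<tau>"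
    and descent: "\<And>k. g (u k) \<bullet> d k + d k \<bullet> (H k *v d k) \<le> - (\<Sum>i\<in>UNIV. \<nu> k $ i * (A *v d k) $ i)"
    and step_power: "\<And>k. \<exists>i. t k = \<sigma> ^ i"
    and armijo: "\<And>k. \<Phi> (u k + t k *\<^sub>R d k) \<le> \<Phi> (u k) - \<rho> * t k * (d k \<bullet> (H k *v d k))"
    and step_maximal: "\<And>k i. \<Phi> (u k + \<sigma> ^ i *\<^sub>R d k) \<le> \<Phi> (u k) - \<rho> * \<sigma> ^ i * (d k \<bullet> (H k *v d k)) \<Longrightarrow>
      \<sigma> ^ i \<le> t k"
    and update: "\<And>k. u (Suc k) = u k + t k *\<^sub>R d k"
    and licq: "\<And>a l. accumulation_point u a \<Longrightarrow> (\<And>i. i \<notin> active_rows A L U a \<Longrightarrow> l $ i = 0) \<Longrightarrow>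
      transpose A *v l = 0 \<Longrightarrow> l = 0"
    and sosc: "\<And>a l z. accumulation_point u a \<Longrightarrow> a \<in> box_polyhedron A L U \<Longrightarrow>
      g a + transpose A *v l = 0 \<Longrightarrow> sign_complementary A L U a l \<Longrightarrow> z \<noteq> 0 \<Longrightarrow>
      (\<And>i. l $ i \<noteq> 0 \<Longrightarrow> (A *v z) $ i = 0) \<Longrightarrow> 0 < z \<bullet> (Hs a *v z)"
    and R_active: "\<And>k. R k \<subseteq> active_rows A L U (u k + d k)"
    and hess_approx: "\<And>\<epsilon>. 0 < \<epsilon> \<Longrightarrow> \<forall>\<^sub>F k in sequentially. \<forall>x.
      \<bar>x \<bullet> ((H k - Hs (u k)) *v d k)\<bar> \<le> (\<epsilon> * norm x + K * (\<Sum>i\<in>R k. \<bar>(A *v x) $ i\<bar>)) * norm (d k)"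
    and strict: "\<And>a l i k. accumulation_point u a \<Longrightarrow> a \<in> box_polyhedron A L U \<Longrightarrow>
      g a + transpose A *v l = 0 \<Longrightarrow> sign_complementary A L U a l \<Longrightarrow> R k \<noteq> {} \<Longrightarrow>
      i \<in> active_rows A L U a \<Longrightarrow> l $ i \<noteq> 0"
begin

section \<open>Line search: the directions tend to zero\<close>

lemma multiplier_gain: "0 \<le> \<nu> k $ i * (A *v d k) $ i"
  using sign_complementary_mono[OF complementary u_feasible, of k i k]
  by (simp add: matrix_vector_right_distrib algebra_simps)

lemma descent0: "g (u k) \<bullet> d k + d k \<bullet> (H k *v d k) \<le> 0"
  using descent[of k] sum_nonneg[of UNIV "\<lambda>i. \<nu> k $ i * (A *v d k) $ i"] multiplier_gain[of k] by force

lemma step_bounds: "0 < t k" "t k \<le> 1"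
  using step_power[of k] params by (auto simp: power_le_one)

lemma norm_d_le: "\<eta> * norm (d k) \<le> norm (g (u k))"
proof (cases "d k = 0")
  case False
  have "\<eta> * norm (d k) * norm (d k) \<le> d k \<bullet> (H k *v d k)"
    using H_coercive[of "d k" k] by (simp add: power2_eq_square)
  also have "\<dots> \<le> norm (g (u k)) * norm (d k)"
    using descent0[of k] Cauchy_Schwarz_ineq2[of "g (u k)" "d k"] by linarith
  finally show ?thesis using False by simp
qed auto

lemma d_bounded: "\<exists>B. \<forall>k. norm (d k) \<le> B"
proof -
  have "compact (g ` closure (range u))"
    by (intro compact_continuous_image continuous_on_subset[OF g_cont]) (use u_bounded in auto)
  then obtain B where B: "\<And>x. x \<in> closure (range u) \<Longrightarrow> norm (g x) \<le> B"
    by (meson bounded_iff compact_imp_bounded imageI)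
  have "norm (d k) \<le> B / \<eta>" for k
  proof -
    have "u k \<in> closure (range u)" by (meson closure_subset rangeI subsetD)
    then show ?thesis using norm_d_le[of k] B[of "u k"] params by (simp add: field_simps)
  qed
  then show ?thesis by blast
qed

text \<open>By coercivity the Armijo condition bounds this quantity by a multiple of the decrease of
  \<open>\<Phi>\<close>. The values of \<open>\<Phi>\<close> are monotone and bounded below, so
  consecutive differences vanish.\<close>

lemma decrease_tendsto_0: "(\<lambda>k. t k * (norm (d k))\<^sup>2) \<longlonglongrightarrow> 0"
proof -
  have contP: "continuous_on S \<Phi>" for S
    by (meson continuous_at_imp_continuous_on deriv has_derivative_continuous)
  have "compact (\<Phi> ` closure (range u))"
    by (intro compact_continuous_image contP) (use u_bounded in auto)
  then obtain B where B: "\<And>x. x \<in> closure (range u) \<Longrightarrow> norm (\<Phi> x) \<le> B"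
    by (meson bounded_iff compact_imp_bounded imageI)
  have "u k \<in> closure (range u)" for k by (meson closure_subset rangeI subsetD)
  with B have lower: "- B \<le> \<Phi> (u k)" for k by (metis abs_le_D2 minus_le_iff real_norm_def)
  have coer: "\<rho> * \<eta> * (t k * (norm (d k))\<^sup>2) \<le> \<Phi> (u k) - \<Phi> (u (Suc k))" for k
  proof -
    have "\<rho> * t k * (\<eta> * (norm (d k))\<^sup>2) \<le> \<rho> * t k * (d k \<bullet> (H k *v d k))"
      using H_coercive[of "d k" k] step_bounds[of k] params by (intro mult_left_mono) auto
    then show ?thesis using armijo[of k] by (simp add: update algebra_simps)
  qed
  have nn: "0 \<le> \<rho> * \<eta> * (t k * (norm (d k))\<^sup>2)" for k
    using params step_bounds[of k] by simp
  have "decseq (\<lambda>k. \<Phi> (u k))"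
  proof (rule decseq_SucI)
    show "\<Phi> (u (Suc k)) \<le> \<Phi> (u k)" for k using coer[of k] nn[of k] by linarith
  qed
  then obtain l where l: "(\<lambda>k. \<Phi> (u k)) \<longlonglongrightarrow> l" using decseq_convergent lower by blast
  have "(\<lambda>k. \<Phi> (u k) - \<Phi> (u (Suc k))) \<longlonglongrightarrow> l - l"
    by (intro tendsto_diff l LIMSEQ_Suc)
  then have "(\<lambda>k. \<rho> * \<eta> * (t k * (norm (d k))\<^sup>2)) \<longlonglongrightarrow> 0"
    using tendsto_sandwich[of "\<lambda>_. 0" "\<lambda>k. \<rho> * \<eta> * (t k * (norm (d k))\<^sup>2)" sequentially
        "\<lambda>k. \<Phi> (u k) - \<Phi> (u (Suc k))" 0] coer nn by auto
  from tendsto_mult_left[OF this, of "1 / (\<rho> * \<eta>)"] show ?thesis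
    using params by simp
qed

text \<open>A damped step means that \<open>t k / \<sigma>\<close> was rejected. The mean value
  theorem turns the rejection into a slope at some \<open>x\<close> that is too large, while
  \<open>descent0\<close> bounds the slope at \<open>u k\<close>; the gradient must change by the
  order of \<open>norm (d k)\<close> between them.\<close>

lemma rejected_step:
  assumes "t k < 1"
  obtains x where "norm (x - u k) \<le> t k / \<sigma> * norm (d k)"
    "(1 - \<rho>) * \<eta> * norm (d k) \<le> norm (g x - g (u k))"
proof -
  obtain i where i: "t k = \<sigma> ^ i" using step_power by blast
  \<comment> \<open>The exponent is not 0 because \<open>t k < 1\<close>, so the previous exponent
    \<open>j\<close> exists, and maximality of \<open>t k\<close> shows that it was
    rejected.\<close>
  with assms obtain j where j: "i = Suc j" by (cases i) auto
  define s where "s = \<sigma> ^ j"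
  have "0 < s" using params by (simp add: s_def)
  moreover have e: "t k = \<sigma> * s" by (simp add: s_def i j)
  ultimately have s: "0 < s" "t k < s" "s = t k / \<sigma>" using params by auto
  then have rej: "\<Phi> (u k + s *\<^sub>R d k) > \<Phi> (u k) - \<rho> * s * (d k \<bullet> (H k *v d k))"
    using step_maximal[of k j] s(2) unfolding s_def[symmetric] by linarith
  obtain z where z: "0 < z" "z < s"
    "\<Phi> (u k + s *\<^sub>R d k) - \<Phi> (u k + 0 *\<^sub>R d k) = (s - 0) * (g (u k + z *\<^sub>R d k) \<bullet> d k)"
    using MVT2[OF \<open>0 < s\<close> has_real_derivative_along_line[OF deriv], of "u k" "d k"] by blast
  define x where "x = u k + z *\<^sub>R d k"
  have "s * (g x \<bullet> d k) > s * (- \<rho> * (d k \<bullet> (H k *v d k)))"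
    using rej z(3) by (simp add: x_def algebra_simps)
  then have "g x \<bullet> d k > - \<rho> * (d k \<bullet> (H k *v d k))"
    using \<open>0 < s\<close> mult_less_cancel_left_pos by blast
  then have "(1 - \<rho>) * (d k \<bullet> (H k *v d k)) \<le> (g x - g (u k)) \<bullet> d k"
    using descent0[of k] by (simp add: inner_diff_left algebra_simps)
  also have "\<dots> \<le> norm (g x - g (u k)) * norm (d k)" by (rule norm_cauchy_schwarz)
  finally have 1: "(1 - \<rho>) * (d k \<bullet> (H k *v d k)) \<le> norm (g x - g (u k)) * norm (d k)" .
  have "(1 - \<rho>) * (\<eta> * (norm (d k))\<^sup>2) \<le> (1 - \<rho>) * (d k \<bullet> (H k *v d k))"
    using H_coercive[of "d k" k] params by (intro mult_left_mono) auto
  with 1 have "(1 - \<rho>) * \<eta> * norm (d k) * norm (d k) \<le> norm (g x - g (u k)) * norm (d k)"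
    by (simp add: power2_eq_square algebra_simps)
  then have "(1 - \<rho>) * \<eta> * norm (d k) \<le> norm (g x - g (u k))"
    by (cases "d k = 0") auto
  moreover have "norm (x - u k) \<le> t k / \<sigma> * norm (d k)"
    using z mult_right_mono[of z s "norm (d k)"] unfolding s(3)[symmetric] by (simp add: x_def)
  ultimately show thesis using that by blast
qed

text \<open>If \<open>norm (d k)\<close> stays above \<open>\<epsilon>\<close> infinitely often,
  uniform continuity of \<open>g\<close> and \<open>rejected_step\<close> keep
  \<open>t k * norm (d k)\<close> away from zero. This contradicts
  \<open>decrease_tendsto_0\<close>.\<close>

lemma d_tendsto_0: "d \<longlonglongrightarrow> 0"
proof (rule ccontr)
  assume "\<not> d \<longlonglongrightarrow> 0"
  then obtain \<epsilon> where \<epsilon>: "0 < \<epsilon>" "\<not> (\<forall>\<^sub>F k in sequentially. dist (d k) 0 < \<epsilon>)"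
    unfolding tendsto_iff by blast
  obtain B where B: "\<And>k. norm (d k) \<le> B" using d_bounded by blast
  obtain Bu where Bu: "\<And>k. norm (u k) \<le> Bu" using u_bounded by (auto simp: bounded_iff)
  have "uniformly_continuous_on (cball 0 (Bu + 1)) g"
    by (intro compact_uniformly_continuous continuous_on_subset[OF g_cont]) auto
  moreover have "0 < (1 - \<rho>) * \<eta> * \<epsilon>" using params \<epsilon> by simp
  ultimately obtain \<delta> where \<delta>: "0 < \<delta>" "\<And>x y. x \<in> cball 0 (Bu + 1) \<Longrightarrow> y \<in> cball 0 (Bu + 1) \<Longrightarrow>
      dist x y < \<delta> \<Longrightarrow> dist (g x) (g y) < (1 - \<rho>) * \<eta> * \<epsilon>"
    unfolding uniformly_continuous_on_def by metis
  \<comment> \<open>The cap 1 keeps the point from \<open>rejected_step\<close> in the ball of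
    radius \<open>Bu + 1\<close> on which \<open>g\<close> is uniformly continuous.\<close>
  define \<delta>' where "\<delta>' = min \<delta> 1"
  \<comment> \<open>The first entry bounds the decrease for damped steps, the second for full
    steps.\<close>
  define m where "m = min (\<sigma> * \<delta>' * \<epsilon>) (\<epsilon>\<^sup>2)"
  have m: "0 < m" using \<delta> \<epsilon> params by (simp add: m_def \<delta>'_def)
  have big: "m \<le> t k * (norm (d k))\<^sup>2" if k: "\<epsilon> \<le> norm (d k)" for k
  proof (cases "t k < 1")
    case True
    obtain x where x: "norm (x - u k) \<le> t k / \<sigma> * norm (d k)"
      "(1 - \<rho>) * \<eta> * norm (d k) \<le> norm (g x - g (u k))"
      using rejected_step[OF True] by blast
    have "\<delta>' \<le> t k / \<sigma> * norm (d k)"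
    proof (rule ccontr)
      assume "\<not> ?thesis"
      with x(1) have lt: "norm (x - u k) < \<delta>'" by simp
      then have "norm x \<le> Bu + 1" using Bu[of k] norm_triangle_sub[of x "u k"] by (simp add: \<delta>'_def)
      then have "dist (g x) (g (u k)) < (1 - \<rho>) * \<eta> * \<epsilon>"
        using \<delta>(2)[of x "u k"] Bu[of k] lt by (simp add: dist_norm \<delta>'_def)
      also have "\<dots> \<le> (1 - \<rho>) * \<eta> * norm (d k)" using params k by (intro mult_left_mono) auto
      finally show False using x(2) by (simp add: dist_norm)
    qed
    then have "\<sigma> * \<delta>' \<le> t k * norm (d k)" using params by (simp add: field_simps)
    then have "\<sigma> * \<delta>' * \<epsilon> \<le> t k * norm (d k) * norm (d k)"
      using k \<epsilon> step_bounds[of k] by (intro mult_mono[of "\<sigma> * \<delta>'"]) auto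
    then show ?thesis by (simp add: m_def power2_eq_square)
  next
    case False
    then have "t k = 1" using step_bounds[of k] by simp
    moreover have "\<epsilon>\<^sup>2 \<le> (norm (d k))\<^sup>2" using k \<epsilon> by (intro power_mono) auto
    ultimately show ?thesis by (simp add: m_def)
  qed
  have "\<forall>\<^sub>F k in sequentially. t k * (norm (d k))\<^sup>2 < m"
    using order_tendstoD(2)[OF decrease_tendsto_0 m] .
  then have "\<forall>\<^sub>F k in sequentially. dist (d k) 0 < \<epsilon>"
    by eventually_elim (use big in \<open>fastforce simp: not_less[symmetric]\<close>)
  with \<epsilon> show False by blast
qed

section \<open>Limits of multipliers\<close>

text \<open>Since \<open>\<tau> > 1\<close>, a factor \<open>norm (d k) powr (\<tau> - 1)\<close>
  can be split off, and it vanishes in the limit.\<close>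

lemma residual_small:
  assumes "0 < \<epsilon>"
  shows "\<forall>\<^sub>F k in sequentially. norm (g (u k) + H k *v d k + transpose A *v \<nu> k) \<le> \<epsilon> * norm (d k)"
proof -
  have "(\<lambda>k. norm (d k)) \<longlonglongrightarrow> 0" using d_tendsto_0 by (rule tendsto_norm_zero)
  then have "(\<lambda>k. norm (d k) powr (\<tau> - 1)) \<longlonglongrightarrow> 0 powr (\<tau> - 1)"
    by (rule tendsto_powr') (use params in auto)
  from tendsto_mult_left[OF this, of C] have "(\<lambda>k. C * norm (d k) powr (\<tau> - 1)) \<longlonglongrightarrow> 0" by simp
  from order_tendstoD(2)[OF this assms] show ?thesis
  proof eventually_elim
    case (elim k)
    have "C * norm (d k) powr \<tau> = C * norm (d k) powr (\<tau> - 1) * norm (d k)"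
      by (cases "d k = 0") (simp_all add: powr_diff)
    also have "\<dots> \<le> \<epsilon> * norm (d k)" using elim by (intro mult_right_mono) auto
    finally show ?case using stationary[of k] by linarith
  qed
qed

text \<open>On vectors supported on the rows active at \<open>a\<close>, \<open>licq\<close> makes
  \<open>transpose A\<close> injective, hence bounded below in norm. The multipliers eventually have
  this support and their images converge to \<open>- g a\<close>, so they form a Cauchy sequence.
  The index map \<open>r\<close> need not be monotone, which allows indices obtained by
  choice.\<close>

lemma multipliers_converge:
  assumes acc: "accumulation_point u a" and r: "filterlim r at_top sequentially" and ua: "(u \<circ> r) \<longlonglongrightarrow> a"
  obtains l where "(\<lambda>j. \<nu> (r j)) \<longlonglongrightarrow> l" "a \<in> box_polyhedron A L U"
    "g a + transpose A *v l = 0" "sign_complementary A L U a l"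
    "\<forall>\<^sub>F j in sequentially. \<forall>i\<in>active_rows A L U (u (r j) + d (r j)).
       (A *v (u (r j) + d (r j) - a)) $ i = 0 \<and> i \<in> active_rows A L U a"
    "(\<lambda>j. u (r j) + d (r j)) \<longlonglongrightarrow> a" "(\<lambda>j. d (r j)) \<longlonglongrightarrow> 0"
proof -
  let ?V = "{l. \<forall>i. i \<notin> active_rows A L U a \<longrightarrow> l $ i = 0}"
  have u: "(\<lambda>j. u (r j)) \<longlonglongrightarrow> a" using ua by (simp add: o_def)
  have dr: "(\<lambda>j. d (r j)) \<longlonglongrightarrow> 0" using filterlim_compose[OF d_tendsto_0 r] .
  have ut: "(\<lambda>j. u (r j) + d (r j)) \<longlonglongrightarrow> a" using tendsto_add[OF u dr] by simp
  have a: "a \<in> box_polyhedron A L U"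
    using closed_sequentially[OF closed_box_polyhedron _ ua, of A L U] u_feasible by simp
  have act: "\<forall>\<^sub>F j in sequentially. \<forall>i.
      (ereal ((A *v (u (r j) + d (r j))) $ i) = L $ i \<longrightarrow> ereal ((A *v a) $ i) = L $ i) \<and>
      (ereal ((A *v (u (r j) + d (r j))) $ i) = U $ i \<longrightarrow> ereal ((A *v a) $ i) = U $ i)"
    by (rule eventually_active_at_limit[OF ut])
  have act': "\<forall>\<^sub>F j in sequentially. \<forall>i\<in>active_rows A L U (u (r j) + d (r j)).
       (A *v (u (r j) + d (r j) - a)) $ i = 0 \<and> i \<in> active_rows A L U a"
    using act
  proof eventually_elim
    case (elim j)
    show ?case
    proof
      fix i assume i: "i \<in> active_rows A L U (u (r j) + d (r j))"
      then have "ereal ((A *v (u (r j) + d (r j))) $ i) = L $ i \<or> ereal ((A *v (u (r j) + d (r j))) $ i) = U $ i"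
        by (simp add: active_rows_def)
      \<comment> \<open>Activity is inherited at the same bound, so the row has exactly the same
        value at the trial point and at \<open>a\<close>.\<close>
      with elim have "ereal ((A *v (u (r j) + d (r j))) $ i) = ereal ((A *v a) $ i)" by metis
      moreover have "i \<in> active_rows A L U a" using i elim unfolding active_rows_def by auto
      ultimately show "(A *v (u (r j) + d (r j) - a)) $ i = 0 \<and> i \<in> active_rows A L U a"
        by (simp add: matrix_vector_mult_diff_distrib)
    qed
  qed
  have V: "subspace ?V" by (auto simp: subspace_def)
  have "\<forall>l\<in>?V. transpose A *v l = 0 \<longrightarrow> l = 0" using licq[OF acc] by blast
  then obtain e where e: "0 < e" "\<forall>l\<in>?V. e * norm l \<le> norm (transpose A *v l)"
    using injective_imp_isometric[OF closed_subspace[OF V] V matrix_vector_mul_bounded_linear] by blast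
  have inV: "\<forall>\<^sub>F j in sequentially. \<nu> (r j) \<in> ?V"
    using act'
  proof eventually_elim
    case (elim j)
    have "i \<in> active_rows A L U a" if "\<nu> (r j) $ i \<noteq> 0" for i
    proof -
      have "i \<in> active_rows A L U (u (r j) + d (r j))"
        using sign_complementary_active[OF complementary that] .
      with elim show ?thesis by blast
    qed
    then show ?case by blast
  qed
  have res: "(\<lambda>k. g (u k) + H k *v d k + transpose A *v \<nu> k) \<longlonglongrightarrow> 0"
  proof (rule Lim_null_comparison)
    show "\<forall>\<^sub>F k in sequentially. norm (g (u k) + H k *v d k + transpose A *v \<nu> k) \<le> 1 * norm (d k)"
      by (rule residual_small) simp
    show "(\<lambda>k. 1 * norm (d k)) \<longlonglongrightarrow> 0" using tendsto_norm_zero[OF d_tendsto_0] by simp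
  qed
  obtain B where B: "\<And>k. norm (H k) \<le> B" using H_bounded by (auto simp: bounded_iff)
  have Hd: "(\<lambda>k. H k *v d k) \<longlonglongrightarrow> 0"
  proof (rule Lim_null_comparison)
    show "\<forall>\<^sub>F k in sequentially. norm (H k *v d k) \<le> B * norm (d k)"
      by (intro always_eventually allI order_trans[OF norm_matrix_vector_mult_le] mult_right_mono B) auto
    show "(\<lambda>k. B * norm (d k)) \<longlonglongrightarrow> 0"
      using tendsto_mult_left[OF tendsto_norm_zero[OF d_tendsto_0], of B] by simp
  qed
  have "isCont g a" using g_cont by (simp add: continuous_on_eq_continuous_at)
  then have gu: "(\<lambda>j. g (u (r j))) \<longlonglongrightarrow> g a" using isCont_tendsto_compose u by blast
  have "(\<lambda>j. (g (u (r j)) + H (r j) *v d (r j) + transpose A *v \<nu> (r j)) - g (u (r j)) - H (r j) *v d (r j))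
      \<longlonglongrightarrow> 0 - g a - 0"
    by (intro tendsto_diff gu filterlim_compose[OF res r] filterlim_compose[OF Hd r])
  then have At: "(\<lambda>j. transpose A *v \<nu> (r j)) \<longlonglongrightarrow> - g a" by simp
  obtain N where N: "\<forall>j\<ge>N. \<nu> (r j) \<in> ?V" using inV unfolding eventually_sequentially by (rule exE)
  have "Cauchy (\<lambda>j. \<nu> (r j))"
  proof (rule metric_CauchyI)
    fix x :: real assume x: "0 < x"
    have "Cauchy (\<lambda>j. transpose A *v \<nu> (r j))" using At by (rule LIMSEQ_imp_Cauchy)
    from metric_CauchyD[OF this, of "e * x"] obtain N' where
      N': "\<And>j j'. j \<ge> N' \<Longrightarrow> j' \<ge> N' \<Longrightarrow> dist (transpose A *v \<nu> (r j)) (transpose A *v \<nu> (r j')) < e * x"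
      using e x by auto
    show "\<exists>M. \<forall>m\<ge>M. \<forall>n\<ge>M. dist (\<nu> (r m)) (\<nu> (r n)) < x"
    proof (intro exI[of _ "max N N'"] allI impI)
      fix m n assume "max N N' \<le> m" "max N N' \<le> n"
      then have mn: "m \<ge> N'" "n \<ge> N'" and V': "\<nu> (r m) \<in> ?V" "\<nu> (r n) \<in> ?V" using N by auto
      have "e * norm (\<nu> (r m) - \<nu> (r n)) \<le> norm (transpose A *v (\<nu> (r m) - \<nu> (r n)))"
        using V' by (intro e(2)[rule_format]) auto
      also have "\<dots> < e * x"
        using N'[OF mn] by (simp add: dist_norm matrix_vector_mult_diff_distrib)
      finally show "dist (\<nu> (r m)) (\<nu> (r n)) < x" using e by (simp add: dist_norm)
    qed
  qed
  then obtain l where l: "(\<lambda>j. \<nu> (r j)) \<longlonglongrightarrow> l" using Cauchy_convergent_iff convergent_def by blast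
  have "transpose A *v l = - g a"
    using LIMSEQ_unique[OF tendsto_matrix_vector_mult[OF l] At] .
  then have stat: "g a + transpose A *v l = 0" by simp
  have "sign_complementary A L U a l"
    unfolding sign_complementary_def
  proof (intro allI conjI impI)
    fix i
    have li: "(\<lambda>j. \<nu> (r j) $ i) \<longlonglongrightarrow> l $ i" by (rule tendsto_vec_nth[OF l])
    { assume "0 < l $ i"
      from order_tendstoD(1)[OF li this] act
      have "\<forall>\<^sub>F j in sequentially. ereal ((A *v a) $ i) = U $ i"
        by eventually_elim (use complementary in \<open>auto simp: sign_complementary_def\<close>)
      then show "ereal ((A *v a) $ i) = U $ i" by simp }
    { assume "l $ i < 0"
      from order_tendstoD(2)[OF li this] act
      have "\<forall>\<^sub>F j in sequentially. ereal ((A *v a) $ i) = L $ i"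
        by eventually_elim (use complementary in \<open>auto simp: sign_complementary_def\<close>)
      then show "ereal ((A *v a) $ i) = L $ i" by simp }
  qed
  with that[OF l a stat _ act' ut dr] show thesis .
qed

section \<open>Second-order estimate of the trial error\<close>

text \<open>Linearizing at \<open>a\<close> costs \<open>\<epsilon> * norm z * norm z\<close>. The
  factor 4 counts the errors of size \<open>\<epsilon> * norm (d k) * norm z\<close>: linearizing
  from the iterate to the trial point, moving the Hessian from \<open>a\<close> to the iterate,
  replacing it by \<open>H k\<close>, and the stationarity residual.\<close>

lemma quadratic_estimate:
  assumes acc: "accumulation_point u a" and r: "filterlim r at_top sequentially" and ua: "(u \<circ> r) \<longlonglongrightarrow> a"
    and \<epsilon>: "0 < \<epsilon>"
  shows "\<forall>\<^sub>F j in sequentially. let z = u (r j) + d (r j) - a in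
    z \<bullet> (Hs a *v z) \<le> \<epsilon> * (norm z + 4 * norm (d (r j))) * norm z"
proof -
  obtain l where l: "(\<lambda>j. \<nu> (r j)) \<longlonglongrightarrow> l" "a \<in> box_polyhedron A L U"
    "g a + transpose A *v l = 0" "sign_complementary A L U a l"
    and act: "\<forall>\<^sub>F j in sequentially. \<forall>i\<in>active_rows A L U (u (r j) + d (r j)).
       (A *v (u (r j) + d (r j) - a)) $ i = 0 \<and> i \<in> active_rows A L U a"
    and ut: "(\<lambda>j. u (r j) + d (r j)) \<longlonglongrightarrow> a" and "(\<lambda>j. d (r j)) \<longlonglongrightarrow> 0"
    by (rule multipliers_converge[OF acc r ua])
  have "a \<in> W" using W l(2) by auto
  obtain \<delta> where \<delta>: "0 < \<delta>"
    "\<And>x y. x \<in> ball a \<delta> \<Longrightarrow> y \<in> ball a \<delta> \<Longrightarrow> norm (g y - g x - Hs a *v (y - x)) \<le> \<epsilon> * norm (y - x)"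
    "\<And>x. x \<in> ball a \<delta> \<Longrightarrow> norm (Hs x - Hs a) \<le> \<epsilon>"
    using strict_derivative[OF W(1) \<open>a \<in> W\<close> \<epsilon> deriv2 Hs_cont] by metis
  have u: "(\<lambda>j. u (r j)) \<longlonglongrightarrow> a" using ua by (simp add: o_def)
  have ball: "\<forall>\<^sub>F j in sequentially. x j \<in> ball a \<delta>" if "x \<longlonglongrightarrow> a" for x
    using tendstoD[OF that \<delta>(1)] by (simp add: dist_commute)
  show ?thesis
    using act ball[OF u] ball[OF ut] eventually_compose_filterlim[OF hess_approx[OF \<epsilon>] r]
      eventually_compose_filterlim[OF residual_small[OF \<epsilon>] r]
  proof eventually_elim
    case (elim j)
    define k where "k = r j"
    define x where "x = u k"
    define y where "y = x + d k"
    define z where "z = y - a"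
    note elim = elim[folded k_def, folded x_def, folded y_def, folded z_def]
    have cs: "z \<bullet> v \<le> c * norm z" if "norm v \<le> c" for v c
      using norm_cauchy_schwarz[of z v] mult_right_mono[OF that norm_ge_zero[of z]]
      by (simp add: mult.commute)
    have "z \<bullet> (- (g y - g a - Hs a *v z)) \<le> \<epsilon> * norm z * norm z"
      using \<delta>(2)[OF _ elim(3), of a] \<delta>(1) by (intro cs) (simp only: norm_minus_cancel, simp add: z_def)
    then have 1: "z \<bullet> (Hs a *v z) \<le> z \<bullet> g y - z \<bullet> g a + \<epsilon> * norm z * norm z"
      by (simp add: inner_diff_right)
    have "z \<bullet> (g y - g x - Hs a *v d k) \<le> \<epsilon> * norm (d k) * norm z"
      using \<delta>(2)[OF elim(2,3)] by (intro cs) (simp add: y_def)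
    then have 2: "z \<bullet> g y \<le> z \<bullet> g x + z \<bullet> (Hs a *v d k) + \<epsilon> * norm (d k) * norm z"
      by (simp add: inner_diff_right)
    have "norm ((Hs x - Hs a) *v d k) \<le> \<epsilon> * norm (d k)"
      using \<delta>(3)[OF elim(2)] by (intro order_trans[OF norm_matrix_vector_mult_le] mult_right_mono) auto
    then have "z \<bullet> (- ((Hs x - Hs a) *v d k)) \<le> \<epsilon> * norm (d k) * norm z"
      by (intro cs) simp
    then have 3: "z \<bullet> (Hs a *v d k) \<le> z \<bullet> (Hs x *v d k) + \<epsilon> * norm (d k) * norm z"
      by (simp add: matrix_vector_mult_diff_rdistrib inner_diff_right)
    have "(\<Sum>i\<in>R k. \<bar>(A *v z) $ i\<bar>) = 0"
      using R_active[of k] elim(1) unfolding x_def y_def by (intro sum.neutral) auto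
    then have "\<bar>z \<bullet> ((H k - Hs x) *v d k)\<bar> \<le> \<epsilon> * norm z * norm (d k)"
      using elim(4) by (metis add.right_neutral mult_zero_right)
    then have 4: "z \<bullet> (Hs x *v d k) \<le> z \<bullet> (H k *v d k) + \<epsilon> * norm (d k) * norm z"
      by (simp add: matrix_vector_mult_diff_rdistrib inner_diff_right algebra_simps)
    have "z \<bullet> (g x + H k *v d k + transpose A *v \<nu> k) \<le> \<epsilon> * norm (d k) * norm z"
      using elim(5) by (rule cs)
    then have 5: "z \<bullet> g x + z \<bullet> (H k *v d k) \<le> - (z \<bullet> (transpose A *v \<nu> k)) + \<epsilon> * norm (d k) * norm z"
      by (simp add: inner_add_right)
    have "z \<bullet> (g a + transpose A *v l) = 0" using l(3) by simp
    then have 6: "z \<bullet> g a = - (z \<bullet> (transpose A *v l))" by (simp add: inner_add_right)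
    \<comment> \<open>Both directions are needed: the multiplier at the trial point is tested with
      \<open>a\<close>, and \<open>l\<close> is tested with the trial point.\<close>
    have "(\<nu> k $ i - l $ i) * (A *v z) $ i \<ge> 0" for i
      using sign_complementary_mono[OF complementary l(2), of k i]
        sign_complementary_mono[OF l(4) trial_feasible, of i k]
      unfolding z_def y_def x_def by (simp add: matrix_vector_mult_diff_distrib algebra_simps)
    then have "0 \<le> (\<Sum>i\<in>UNIV. (\<nu> k $ i - l $ i) * (A *v z) $ i)" by (intro sum_nonneg) auto
    then have 7: "z \<bullet> (transpose A *v l) \<le> z \<bullet> (transpose A *v \<nu> k)"
      unfolding inner_transpose_sum by (simp add: left_diff_distrib sum_subtractf)
    have "z \<bullet> (Hs a *v z) \<le> \<epsilon> * norm z * norm z + 4 * (\<epsilon> * norm (d k) * norm z)"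
      using 1 2 3 4 5 6 7 by linarith
    then show ?case
      unfolding Let_def k_def[symmetric] x_def[symmetric] y_def[symmetric] z_def[symmetric]
      by (simp add: algebra_simps)
  qed
qed

text \<open>If the trial error \<open>z\<close> were not negligible against \<open>u - a\<close>, then \<open>d\<close> would be of the order of
  \<open>z\<close>, and a limit of \<open>z / |z|\<close> would violate the second-order condition.\<close>

lemma trial_error:
  assumes acc: "accumulation_point u a" and r: "filterlim r at_top sequentially" and ua: "(u \<circ> r) \<longlonglongrightarrow> a"
    and \<epsilon>: "0 < \<epsilon>"
  shows "\<forall>\<^sub>F j in sequentially. norm (u (r j) + d (r j) - a) \<le> \<epsilon> * norm (u (r j) - a)"
proof (rule ccontr)
  assume "\<not> ?thesis"
  from infinite_enumerate[OF infinite_not_eventually[OF this]] obtain q :: "nat \<Rightarrow> nat" where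
    q': "strict_mono q" "\<forall>j. q j \<in> {j. \<not> norm (u (r j) + d (r j) - a) \<le> \<epsilon> * norm (u (r j) - a)}"
    by blast
  then have q: "strict_mono q" "\<epsilon> * norm (u (r (q j)) - a) < norm (u (r (q j)) + d (r (q j)) - a)" for j
    by (auto simp: not_le)
  define z where "z j = u (r (q j)) + d (r (q j)) - a" for j
  have z0: "z j \<noteq> 0" for j
  proof -
    have "0 \<le> \<epsilon> * norm (u (r (q j)) - a)" using \<epsilon> by simp
    with q(2)[of j] have "0 < norm (z j)" unfolding z_def by linarith
    then show ?thesis by simp
  qed
  have "\<forall>j. z j /\<^sub>R norm (z j) \<in> sphere 0 1" using z0 by simp
  then obtain v s where v: "v \<in> sphere 0 1" "strict_mono s" "((\<lambda>j. z j /\<^sub>R norm (z j)) \<circ> s) \<longlonglongrightarrow> v"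
    by (rule seq_compactE[OF compact_imp_seq_compact[OF compact_sphere]])
  define p where "p = r \<circ> q \<circ> s"
  have qs: "strict_mono (q \<circ> s)" using q(1) v(2) by (rule strict_mono_o)
  have p: "filterlim p at_top sequentially"
    using filterlim_compose[OF r filterlim_subseq[OF qs]] by (simp add: p_def o_def)
  have up: "(u \<circ> p) \<longlonglongrightarrow> a"
    using LIMSEQ_subseq_LIMSEQ[OF ua qs] by (simp add: p_def o_assoc)
  define y where "y j = z (s j)" for j
  have y_eq: "u (p j) + d (p j) - a = y j" for j by (simp add: y_def z_def p_def)
  have y0: "y j \<noteq> 0" for j using z0 by (simp add: y_def)
  have yv: "(\<lambda>j. y j /\<^sub>R norm (y j)) \<longlonglongrightarrow> v" using v(3) by (simp add: y_def o_def)
  have dp: "norm (d (p j)) \<le> (1 + 1 / \<epsilon>) * norm (y j)" for j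
  proof -
    have "norm (u (p j) - a) \<le> 1 / \<epsilon> * norm (y j)"
      using q(2)[of "s j"] \<epsilon> by (simp add: y_def z_def p_def field_simps)
    moreover have "d (p j) = y j - (u (p j) - a)" by (simp flip: y_eq)
    then have "norm (d (p j)) \<le> norm (y j) + norm (u (p j) - a)" by (metis norm_triangle_ineq4)
    ultimately show ?thesis by (simp add: distrib_right)
  qed
  obtain l where l: "(\<lambda>j. \<nu> (p j)) \<longlonglongrightarrow> l" "a \<in> box_polyhedron A L U"
    "g a + transpose A *v l = 0" "sign_complementary A L U a l"
    and act: "\<forall>\<^sub>F j in sequentially. \<forall>i\<in>active_rows A L U (u (p j) + d (p j)).
       (A *v (u (p j) + d (p j) - a)) $ i = 0 \<and> i \<in> active_rows A L U a"
    and "(\<lambda>j. u (p j) + d (p j)) \<longlonglongrightarrow> a" "(\<lambda>j. d (p j)) \<longlonglongrightarrow> 0"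
    by (rule multipliers_converge[OF acc p up])
  \<comment> \<open>A nonzero limit multiplier is eventually nonzero along the sequence, so its row
    is active at the trial points and annihilates \<open>y j\<close> exactly. This survives
    normalization and passes to the limit direction.\<close>
  have "(A *v v) $ i = 0" if i: "l $ i \<noteq> 0" for i
  proof -
    have li: "(\<lambda>j. \<nu> (p j) $ i) \<longlonglongrightarrow> l $ i" by (rule tendsto_vec_nth[OF l(1)])
    have zero: "\<forall>\<^sub>F j in sequentially. (A *v (y j /\<^sub>R norm (y j))) $ i = 0"
      using tendsto_imp_eventually_ne[OF li i] act
    proof eventually_elim
      case (elim j)
      have "i \<in> active_rows A L U (u (p j) + d (p j))"
        using sign_complementary_active[OF complementary elim(1)] .
      with elim(2) show ?case by (simp add: y_eq matrix_vector_mult_scaleR)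
    qed
    have "(\<lambda>j. (A *v (y j /\<^sub>R norm (y j))) $ i) \<longlonglongrightarrow> (A *v v) $ i"
      by (rule tendsto_vec_nth[OF tendsto_matrix_vector_mult[OF yv]])
    from LIMSEQ_unique[OF this tendsto_eventually[OF zero]] show ?thesis .
  qed
  moreover have "v \<noteq> 0" using v(1) by auto
  ultimately have pos: "0 < v \<bullet> (Hs a *v v)" by (intro sosc[OF acc l(2-4)]) auto
  \<comment> \<open>\<open>c\<close> bounds \<open>norm z + 4 * norm d\<close> in units of
    \<open>norm z\<close> through \<open>dp\<close>; \<open>\<epsilon>'\<close> is then chosen so
    that \<open>\<epsilon>' * c\<close> is half of the positive limit value.\<close>
  define c where "c = 1 + 4 * (1 + 1 / \<epsilon>)"
  have c: "0 < c" using \<epsilon> by (simp add: c_def add_pos_pos)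
  define \<epsilon>' where "\<epsilon>' = v \<bullet> (Hs a *v v) / (2 * c)"
  have \<epsilon>': "0 < \<epsilon>'" using pos c by (simp add: \<epsilon>'_def)
  have le: "\<forall>\<^sub>F j in sequentially. (y j /\<^sub>R norm (y j)) \<bullet> (Hs a *v (y j /\<^sub>R norm (y j))) \<le> \<epsilon>' * c"
    using quadratic_estimate[OF acc p up \<epsilon>']
  proof eventually_elim
    case (elim j)
    have "y j \<bullet> (Hs a *v y j) \<le> \<epsilon>' * (norm (y j) + 4 * norm (d (p j))) * norm (y j)"
      using elim by (simp add: y_eq Let_def)
    also have "\<dots> \<le> \<epsilon>' * (c * norm (y j)) * norm (y j)"
    proof (intro mult_right_mono mult_left_mono)
      have "c * norm (y j) = norm (y j) + 4 * ((1 + 1 / \<epsilon>) * norm (y j))"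
        unfolding c_def by (simp only: distrib_right mult.assoc mult_1_left)
      then show "norm (y j) + 4 * norm (d (p j)) \<le> c * norm (y j)" using dp[of j] by linarith
    qed (use \<epsilon>' in auto)
    finally have *: "y j \<bullet> (Hs a *v y j) \<le> \<epsilon>' * c * (norm (y j))\<^sup>2"
      by (simp add: power2_eq_square mult_ac)
    have "(y j /\<^sub>R norm (y j)) \<bullet> (Hs a *v (y j /\<^sub>R norm (y j))) = y j \<bullet> (Hs a *v y j) / (norm (y j))\<^sup>2"
      by (simp add: matrix_vector_mult_scaleR divide_inverse power2_eq_square)
    also have "\<dots> \<le> \<epsilon>' * c" using * y0[of j] by (simp add: pos_divide_le_eq)
    finally show ?case .
  qed
  have "(\<lambda>j. (y j /\<^sub>R norm (y j)) \<bullet> (Hs a *v (y j /\<^sub>R norm (y j)))) \<longlonglongrightarrow> v \<bullet> (Hs a *v v)"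
    by (rule tendsto_inner[OF yv tendsto_matrix_vector_mult[OF yv]])
  from tendsto_upperbound[OF this le sequentially_bot] show False using pos c by (simp add: \<epsilon>'_def)
qed

text \<open>Near an accumulation point a full step does not increase the distance to it, hence neither does a
  damped one: the sequence is trapped, and no isolatedness argument is needed.\<close>

lemma converges:
  obtains a where "u \<longlonglongrightarrow> a" "accumulation_point u a"
proof -
  obtain a r where r: "strict_mono r" "(u \<circ> r) \<longlonglongrightarrow> a"
    using bounded_imp_convergent_subsequence[OF u_bounded] by metis
  then have acc: "accumulation_point u a" by (auto simp: accumulation_point_def)
  \<comment> \<open>Otherwise, for each \<open>N\<close> some index \<open>f N\<close> past
    \<open>N\<close> lies within \<open>inverse (Suc N)\<close> of \<open>a\<close> and violates the
    bound. These iterates tend to \<open>a\<close>, contradicting \<open>trial_error\<close> with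
    constant 1.\<close>
  have "\<exists>N. \<forall>k\<ge>N. norm (u k - a) < inverse (Suc N) \<longrightarrow> norm (u k + d k - a) \<le> 1 * norm (u k - a)"
  proof (rule ccontr)
    assume "\<not> ?thesis"
    then obtain f where f: "\<And>N. f N \<ge> N" "\<And>N. norm (u (f N) - a) < inverse (Suc N)"
      "\<And>N. \<not> norm (u (f N) + d (f N) - a) \<le> 1 * norm (u (f N) - a)" by metis
    have "filterlim f at_top sequentially"
      by (rule filterlim_at_top_mono[OF filterlim_ident]) (simp add: f(1))
    moreover have "(u \<circ> f) \<longlonglongrightarrow> a"
    proof -
      have "(\<lambda>N. u (f N) - a) \<longlonglongrightarrow> 0"
        using f(2) by (intro Lim_null_comparison[OF _ LIMSEQ_inverse_real_of_nat])
          (auto intro!: always_eventually less_imp_le)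
      then show ?thesis by (simp add: o_def LIM_zero_iff)
    qed
    ultimately have "\<forall>\<^sub>F j in sequentially. norm (u (f j) + d (f j) - a) \<le> 1 * norm (u (f j) - a)"
      using trial_error[OF acc] zero_less_one by blast
    with f(3) show False by simp
  qed
  then obtain N where N: "\<And>k. k \<ge> N \<Longrightarrow> norm (u k - a) < inverse (Suc N) \<Longrightarrow>
      norm (u k + d k - a) \<le> norm (u k - a)" by auto
  have step: "norm (u (Suc k) - a) \<le> norm (u k - a)" if "k \<ge> N" "norm (u k - a) < inverse (Suc N)" for k
  proof -
    have "u (Suc k) - a = (1 - t k) *\<^sub>R (u k - a) + t k *\<^sub>R (u k + d k - a)"
      by (simp add: update algebra_simps)
    then have "norm (u (Suc k) - a) \<le> (1 - t k) * norm (u k - a) + t k * norm (u k + d k - a)"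
      using norm_triangle_ineq[of "(1 - t k) *\<^sub>R (u k - a)" "t k *\<^sub>R (u k + d k - a)"] step_bounds[of k] by simp
    also have "\<dots> \<le> (1 - t k) * norm (u k - a) + t k * norm (u k - a)"
      using step_bounds[of k] N[OF that] by (intro add_left_mono mult_left_mono) auto
    finally show ?thesis by (simp add: algebra_simps)
  qed
  have "u \<longlonglongrightarrow> a"
  proof (rule LIMSEQ_I)
    fix x :: real assume x: "0 < x"
    define m where "m = min x (inverse (Suc N))"
    have "0 < m" using x by (simp add: m_def)
    obtain j0 where j0: "\<And>j. j \<ge> j0 \<Longrightarrow> norm (u (r j) - a) < m"
      using LIMSEQ_D[OF r(2) \<open>0 < m\<close>] by auto
    \<comment> \<open>The index must be late enough both for closeness to \<open>a\<close> and for
      \<open>step\<close> to apply from there on.\<close>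
    define k0 where "k0 = r (max j0 N)"
    have "k0 \<ge> N" using seq_suble[OF r(1), of "max j0 N"] by (simp add: k0_def)
    have "norm (u k - a) < m" if "k \<ge> k0" for k
      using that
    proof (induction k rule: dec_induct)
      case base then show ?case using j0 by (simp add: k0_def)
    next
      case (step k)
      then show ?case using \<open>k0 \<ge> N\<close> \<open>\<And>k. N \<le> k \<Longrightarrow> _ \<Longrightarrow> norm (u (Suc k) - a) \<le> _\<close>[of k]
        by (simp add: m_def)
    qed
    then show "\<exists>no. \<forall>n\<ge>no. norm (u n - a) < x" by (auto simp: m_def)
  qed
  with acc show thesis using that by blast
qed

section \<open>Acceptance of the unit step and the rate\<close>

text \<open>A single nonempty \<open>R k\<close> makes \<open>strict\<close> available, so all rows
  active at \<open>a\<close> have nonzero limit multipliers. Rows in \<open>R k\<close> are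
  eventually among them, and half the limit value is a lower bound.\<close>

lemma active_multipliers_bounded_below:
  assumes ua: "u \<longlonglongrightarrow> a" and acc: "accumulation_point u a"
  obtains \<kappa> where "0 < \<kappa>" "\<forall>\<^sub>F k in sequentially. \<forall>i\<in>R k. \<kappa> \<le> \<bar>\<nu> k $ i\<bar>"
proof (cases "\<forall>k. R k = {}")
  case True
  then show thesis using that[of 1] by simp
next
  case False
  then obtain k0 where k0: "R k0 \<noteq> {}" by blast
  have r: "filterlim (\<lambda>j::nat. j) at_top sequentially" by (rule filterlim_ident)
  have ur: "(u \<circ> (\<lambda>j. j)) \<longlonglongrightarrow> a" using ua by (simp add: o_def)
  obtain l where l: "\<nu> \<longlonglongrightarrow> l" "a \<in> box_polyhedron A L U"
    "g a + transpose A *v l = 0" "sign_complementary A L U a l"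
    and act: "\<forall>\<^sub>F j in sequentially. \<forall>i\<in>active_rows A L U (u j + d j).
       (A *v (u j + d j - a)) $ i = 0 \<and> i \<in> active_rows A L U a"
    and "(\<lambda>j. u j + d j) \<longlonglongrightarrow> a" "d \<longlonglongrightarrow> 0"
    by (rule multipliers_converge[OF acc r ur])
  have nz: "l $ i \<noteq> 0" if "i \<in> active_rows A L U a" for i
    using strict[OF acc l(2-4) k0 that] .
  \<comment> \<open>Inserting 1 keeps the minimum defined when no row is active at
    \<open>a\<close>.\<close>
  define \<kappa> where "\<kappa> = Min (insert 1 ((\<lambda>i. \<bar>l $ i\<bar> / 2) ` active_rows A L U a))"
  have "0 < \<kappa>" using nz by (auto simp: \<kappa>_def)
  have "\<forall>\<^sub>F k in sequentially. \<forall>i. i \<in> active_rows A L U a \<longrightarrow> \<kappa> \<le> \<bar>\<nu> k $ i\<bar>"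
  proof (rule eventually_all_finite)
    fix i
    show "\<forall>\<^sub>F k in sequentially. i \<in> active_rows A L U a \<longrightarrow> \<kappa> \<le> \<bar>\<nu> k $ i\<bar>"
    proof (cases "i \<in> active_rows A L U a")
      case True
      have "\<bar>l $ i\<bar> / 2 < \<bar>l $ i\<bar>" using nz[OF True] by simp
      from order_tendstoD(1)[OF tendsto_rabs[OF tendsto_vec_nth[OF l(1)]] this]
      show ?thesis
      proof eventually_elim
        case (elim k)
        moreover have "\<kappa> \<le> \<bar>l $ i\<bar> / 2" using True unfolding \<kappa>_def by (intro Min_le) auto
        ultimately show ?case by simp
      qed
    qed auto
  qed
  with act have "\<forall>\<^sub>F k in sequentially. \<forall>i\<in>R k. \<kappa> \<le> \<bar>\<nu> k $ i\<bar>"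
    by eventually_elim (use R_active in blast)
  with \<open>0 < \<kappa>\<close> show thesis using that by blast
qed

text \<open>The part of the Hessian error in the row space of \<open>P\<^sub>k\<close> is \<open>O(|A d| |d|)\<close>, with \<open>A d\<close>
  restricted to \<open>R k\<close>; the descent term \<open>\<Sum>i. \<nu>\<^sub>i (A d)\<^sub>i\<close> dominates it because the
  multipliers stay away from zero there.\<close>

lemma eventually_unit_step:
  assumes ua: "u \<longlonglongrightarrow> a" and acc: "accumulation_point u a"
  shows "\<forall>\<^sub>F k in sequentially. t k = 1"
proof -
  have "a \<in> W"
    using closed_sequentially[OF closed_box_polyhedron _ ua, of A L U] u_feasible W by auto
  \<comment> \<open>The Taylor error costs \<open>\<epsilon>\<close> and the two Hessian
    replacements cost half of \<open>\<epsilon>\<close> each, all times the squared norm of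
    \<open>d k\<close>. The total \<open>2 * \<epsilon>\<close> must fit into the margin
    \<open>(1/2 - \<rho>) * \<eta>\<close>.\<close>
  define \<epsilon> where "\<epsilon> = (1/2 - \<rho>) * \<eta> / 2"
  have \<epsilon>: "0 < \<epsilon>" using params by (simp add: \<epsilon>_def)
  obtain \<delta> where \<delta>: "0 < \<delta>"
    "\<And>x y. x \<in> ball a \<delta> \<Longrightarrow> y \<in> ball a \<delta> \<Longrightarrow> norm (g y - g x - Hs a *v (y - x)) \<le> \<epsilon> * norm (y - x)"
    "\<And>x. x \<in> ball a \<delta> \<Longrightarrow> norm (Hs x - Hs a) \<le> \<epsilon>"
    using strict_derivative[OF W(1) \<open>a \<in> W\<close> \<epsilon> deriv2 Hs_cont] by metis
  obtain \<kappa> where \<kappa>: "0 < \<kappa>" "\<forall>\<^sub>F k in sequentially. \<forall>i\<in>R k. \<kappa> \<le> \<bar>\<nu> k $ i\<bar>"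
    using active_multipliers_bounded_below[OF ua acc] .
  have ut: "(\<lambda>k. u k + d k) \<longlonglongrightarrow> a" using tendsto_add[OF ua d_tendsto_0] by simp
  have ball: "\<forall>\<^sub>F j in sequentially. x j \<in> ball a \<delta>" if "x \<longlonglongrightarrow> a" for x
    using tendstoD[OF that \<delta>(1)] by (simp add: dist_commute)
  have "(\<lambda>k. K * norm (d k)) \<longlonglongrightarrow> 0"
    using tendsto_mult_left[OF tendsto_norm_zero[OF d_tendsto_0], of K] by simp
  then have small: "\<forall>\<^sub>F k in sequentially. K * norm (d k) < \<kappa>"
    using \<kappa>(1) by (rule order_tendstoD)
  show ?thesis
    using ball[OF ua] ball[OF ut] \<kappa>(2) hess_approx[OF \<epsilon>] small
  proof eventually_elim
    case (elim k)
    define S where "S = (\<Sum>i\<in>R k. \<bar>(A *v d k) $ i\<bar>)"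
    have "0 \<le> S" by (simp add: S_def sum_nonneg)
    have 1: "\<Phi> (u k + d k) - \<Phi> (u k) \<le>
        g (u k) \<bullet> d k + (1/2) * (d k \<bullet> (Hs a *v d k)) + \<epsilon> * (norm (d k))\<^sup>2"
      using \<epsilon> elim(1,2) by (intro second_order_expansion[OF deriv \<delta>(2)]) auto
    have "\<bar>d k \<bullet> ((Hs (u k) - Hs a) *v d k)\<bar> \<le> norm (d k) * norm ((Hs (u k) - Hs a) *v d k)"
      by (rule Cauchy_Schwarz_ineq2)
    also have "\<dots> \<le> norm (d k) * (\<epsilon> * norm (d k))"
      using \<delta>(3)[OF elim(1)]
      by (intro mult_left_mono order_trans[OF norm_matrix_vector_mult_le] mult_right_mono) auto
    finally have 2: "d k \<bullet> (Hs a *v d k) \<le> d k \<bullet> (Hs (u k) *v d k) + \<epsilon> * (norm (d k))\<^sup>2"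
      by (simp add: matrix_vector_mult_diff_rdistrib inner_diff_right power2_eq_square algebra_simps)
    have "\<bar>d k \<bullet> ((H k - Hs (u k)) *v d k)\<bar> \<le> \<epsilon> * (norm (d k))\<^sup>2 + K * norm (d k) * S"
      using elim(4)[rule_format, of "d k"] by (simp add: S_def power2_eq_square algebra_simps)
    moreover have "K * norm (d k) * S \<le> \<kappa> * S" using elim(5) \<open>0 \<le> S\<close> by (intro mult_right_mono) auto
    ultimately have 3: "d k \<bullet> (Hs (u k) *v d k) \<le> d k \<bullet> (H k *v d k) + \<epsilon> * (norm (d k))\<^sup>2 + \<kappa> * S"
      by (simp add: matrix_vector_mult_diff_rdistrib inner_diff_right)
    have "\<kappa> * S \<le> (\<Sum>i\<in>R k. \<nu> k $ i * (A *v d k) $ i)"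
      unfolding S_def sum_distrib_left
    proof (rule sum_mono)
      fix i assume "i \<in> R k"
      then have "\<kappa> * \<bar>(A *v d k) $ i\<bar> \<le> \<bar>\<nu> k $ i\<bar> * \<bar>(A *v d k) $ i\<bar>"
        using elim(3) by (intro mult_right_mono) auto
      also have "\<dots> = \<nu> k $ i * (A *v d k) $ i"
        using multiplier_gain[of k i] by (simp flip: abs_mult)
      finally show "\<kappa> * \<bar>(A *v d k) $ i\<bar> \<le> \<nu> k $ i * (A *v d k) $ i" .
    qed
    also have "\<dots> \<le> (\<Sum>i\<in>UNIV. \<nu> k $ i * (A *v d k) $ i)"
      by (intro sum_mono2) (auto simp: multiplier_gain)
    finally have 4: "g (u k) \<bullet> d k + d k \<bullet> (H k *v d k) \<le> - (\<kappa> * S)"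
      using descent[of k] by linarith
    have "0 \<le> \<kappa> * S" using \<kappa>(1) \<open>0 \<le> S\<close> by simp
    have "(1/2 - \<rho>) * (\<eta> * (norm (d k))\<^sup>2) \<le> (1/2 - \<rho>) * (d k \<bullet> (H k *v d k))"
      using params H_coercive[of "d k" k] by (intro mult_left_mono) auto
    then have 5: "2 * (\<epsilon> * (norm (d k))\<^sup>2) \<le> (1/2) * (d k \<bullet> (H k *v d k)) - \<rho> * (d k \<bullet> (H k *v d k))"
      by (simp add: \<epsilon>_def left_diff_distrib)
    \<comment> \<open>The expansion contributes \<open>\<kappa> * S / 2\<close>, while the descent
      in fact 4 supplies \<open>- \<kappa> * S\<close>, which absorbs it.\<close>
    have "\<Phi> (u k + d k) \<le> \<Phi> (u k) - \<rho> * (d k \<bullet> (H k *v d k))"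
      using 1 2 3 4 5 \<open>0 \<le> \<kappa> * S\<close> by linarith
    then have "1 \<le> t k" using step_maximal[of k 0] by simp
    with step_bounds[of k] show ?case by simp
  qed
qed

theorem superlinear_convergence:
  "\<exists>a. u \<longlonglongrightarrow> a \<and> (\<lambda>k. norm (u (Suc k) - a)) \<in> o(\<lambda>k. norm (u k - a))"
proof -
  obtain a where ua: "u \<longlonglongrightarrow> a" and acc: "accumulation_point u a" using converges .
  have "(\<lambda>k. norm (u (Suc k) - a)) \<in> o(\<lambda>k. norm (u k - a))"
  proof (rule landau_o.smallI)
    fix c :: real assume "0 < c"
    have "(u \<circ> (\<lambda>j. j)) \<longlonglongrightarrow> a" using ua by (simp add: o_def)
    from trial_error[OF acc filterlim_ident this \<open>0 < c\<close>] eventually_unit_step[OF ua acc]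
    show "\<forall>\<^sub>F k in sequentially. norm (norm (u (Suc k) - a)) \<le> c * norm (norm (u k - a))"
      by eventually_elim (simp add: update)
  qed
  with ua show ?thesis by blast
qed

end

section \<open>The structured problem\<close>

text \<open>A nontrivial relation puts one selected row into the span of the other selected rows, so
  the rank is less than \<open>card R\<close>.\<close>

lemma full_row_rank_injective:
  fixes A :: "real ^ 'c ^ 'r::finite"
  assumes full: "full_row_rank R A" and l: "\<And>i. i \<notin> R \<Longrightarrow> l $ i = 0" "transpose A *v l = 0"
  shows "l = 0"
proof (rule ccontr)
  assume "l \<noteq> 0"
  then obtain i where i: "l $ i \<noteq> 0" by (auto simp: vec_eq_iff)
  with l(1) have iR: "i \<in> R" by blast
  let ?S = "(\<lambda>j. A $ j) ` (R - {i})"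
  have "0 = (\<Sum>j\<in>UNIV. l $ j *\<^sub>R A $ j)"
    using l(2) by (simp add: matrix_mult_sum scalar_mult_eq_scaleR column_def transpose_def)
  also have "\<dots> = (\<Sum>j\<in>R. l $ j *\<^sub>R A $ j)" using l(1) by (intro sum.mono_neutral_right) auto
  also have "\<dots> = l $ i *\<^sub>R A $ i + (\<Sum>j\<in>R - {i}. l $ j *\<^sub>R A $ j)"
    using iR by (simp add: sum.remove)
  finally have "l $ i *\<^sub>R A $ i = - (\<Sum>j\<in>R - {i}. l $ j *\<^sub>R A $ j)"
    by (simp add: eq_neg_iff_add_eq_0)
  moreover have "- (\<Sum>j\<in>R - {i}. l $ j *\<^sub>R A $ j) \<in> span ?S"
    by (intro span_neg span_sum span_scale span_base) auto
  ultimately have "(1 / l $ i) *\<^sub>R (l $ i *\<^sub>R A $ i) \<in> span ?S"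
    by (metis span_scale)
  then have "A $ i \<in> span ?S" using i by simp
  then have "row_submatrix R A $ j \<in> span ?S" for j
    by (cases "j = i") (auto simp: row_submatrix_def span_zero intro: span_base)
  then have "rows (row_submatrix R A) \<subseteq> span ?S"
    by (auto simp: rows_def row_def)
  then have "rank (row_submatrix R A) \<le> card ?S"
    unfolding row_rank_def by (rule dim_le_card) simp
  also have "\<dots> \<le> card (R - {i})" by (rule card_image_le) simp
  also have "\<dots> < card R" using iR by (meson card_Diff1_less finite)
  finally show False using full by (simp add: full_row_rank_def)
qed

text \<open>No property of \<^const>\<open>matrix_inv_on\<close> enters, so this also holds where \<open>B B\<^sup>T\<close> is singular and
  \<^const>\<open>matrix_inv_on\<close> is arbitrary. The constant is uniform since there are finitely many \<open>R\<close>.\<close>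

lemma null_projection_bound:
  fixes A :: "real ^ 'c ^ 'r::finite"
  obtains K where "0 \<le> K"
    "\<And>R x v. \<bar>x \<bullet> v\<bar> \<le> norm x * norm (null_projection R A *v v) + K * (\<Sum>i\<in>R. \<bar>(A *v x) $ i\<bar>) * norm v"
proof -
  define c where "c R = norm (matrix_inv_on R (row_submatrix R A ** transpose (row_submatrix R A)))
    * norm (row_submatrix R A)" for R
  have c0: "0 \<le> c R" for R by (simp add: c_def)
  have "\<bar>x \<bullet> v\<bar> \<le> norm x * norm (null_projection R A *v v) + sum c UNIV * (\<Sum>i\<in>R. \<bar>(A *v x) $ i\<bar>) * norm v"
    for R x v
  proof -
    define B where "B = row_submatrix R A"
    define N where "N = matrix_inv_on R (B ** transpose B)"
    have P: "null_projection R A *v v = v - transpose B *v (N *v (B *v v))"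
      by (simp add: null_projection_def Let_def B_def N_def matrix_vector_mult_diff_rdistrib
          flip: matrix_vector_mul_assoc)
    have Bx: "(B *v x) $ i = (if i \<in> R then (A *v x) $ i else 0)" for i
      by (simp add: B_def row_submatrix_def matrix_vector_mul_component)
    have nBx: "norm (B *v x) \<le> (\<Sum>i\<in>R. \<bar>(A *v x) $ i\<bar>)"
    proof -
      have "norm (B *v x) \<le> (\<Sum>i\<in>UNIV. \<bar>(B *v x) $ i\<bar>)" by (rule norm_le_l1_cart)
      also have "\<dots> = (\<Sum>i\<in>R. \<bar>(A *v x) $ i\<bar>)"
        by (rule sum.mono_neutral_cong_right) (auto simp: Bx)
      finally show ?thesis .
    qed
    \<comment> \<open>The part removed by the projection is moved onto \<open>x\<close> by
      transposition, where only the rows in \<open>R\<close> see it.\<close>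
    have "x \<bullet> v = x \<bullet> (null_projection R A *v v) + (B *v x) \<bullet> (N *v (B *v v))"
      unfolding P inner_diff_right inner_transpose_vector by simp
    then have "\<bar>x \<bullet> v\<bar> \<le> norm x * norm (null_projection R A *v v) + norm (B *v x) * norm (N *v (B *v v))"
      using Cauchy_Schwarz_ineq2[of x "null_projection R A *v v"]
        Cauchy_Schwarz_ineq2[of "B *v x" "N *v (B *v v)"] by linarith
    also have "norm (B *v x) * norm (N *v (B *v v)) \<le> (\<Sum>i\<in>R. \<bar>(A *v x) $ i\<bar>) * (c R * norm v)"
    proof (rule mult_mono[OF nBx])
      have "norm (N *v (B *v v)) \<le> norm N * (norm B * norm v)"
        by (rule order_trans[OF norm_matrix_vector_mult_le mult_left_mono[OF norm_matrix_vector_mult_le]]) simp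
      then show "norm (N *v (B *v v)) \<le> c R * norm v" by (simp add: c_def N_def B_def mult.assoc)
    qed (auto simp: sum_nonneg)
    also have "\<dots> \<le> (\<Sum>i\<in>R. \<bar>(A *v x) $ i\<bar>) * (sum c UNIV * norm v)"
      by (intro mult_left_mono mult_right_mono member_le_sum) (auto simp: c0 sum_nonneg)
    finally show ?thesis by (simp add: mult_ac)
  qed
  then show thesis using that[of "sum c UNIV"] c0 by (simp add: sum_nonneg)
qed

section \<open>Block vectors and matrices\<close>

lemma xpart_stack [simp]: "xpart (stack x y) = x"
  and ypart_stack [simp]: "ypart (stack x y) = y"
  and stack_parts [simp]: "stack (xpart u) (ypart u) = u"
  and stack_nth_Inl [simp]: "stack x y $ Inl i = x $ i"
  and stack_nth_Inr [simp]: "stack x y $ Inr j = y $ j"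
  and xpart_nth: "xpart u $ i = u $ Inl i"
  and ypart_nth: "ypart u $ j = u $ Inr j"
  by (auto simp: xpart_def ypart_def stack_def vec_eq_iff split: sum.splits)

lemma inner_stack: "u \<bullet> v = xpart u \<bullet> xpart v + ypart u \<bullet> ypart v"
  by (simp add: inner_vec_def xpart_nth ypart_nth sum.Plus flip: UNIV_Plus_UNIV)

lemma xpart_simps [simp]:
  fixes u v :: "real ^ ('n::finite + 'p::finite)"
  shows "xpart (u + v) = xpart u + xpart v" "xpart (u - v) = xpart u - xpart v"
    "xpart (c *\<^sub>R u) = c *\<^sub>R xpart u" "xpart (- u) = - xpart u" "xpart (0 :: real ^ ('n + 'p)) = 0"
    "ypart (u + v) = ypart u + ypart v" "ypart (u - v) = ypart u - ypart v"
    "ypart (c *\<^sub>R u) = c *\<^sub>R ypart u" "ypart (- u) = - ypart u" "ypart (0 :: real ^ ('n + 'p)) = 0"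
  by (simp_all add: xpart_def ypart_def vec_eq_iff)

lemma stack_eq_iff: "u = v \<longleftrightarrow> xpart u = xpart v \<and> ypart u = ypart v"
  by (metis stack_parts)

lemma norm_stack_le: "norm (stack x y :: real ^ ('n::finite + 'p::finite)) \<le> norm x + norm y"
proof -
  have "(norm (stack x y :: real ^ ('n + 'p)))\<^sup>2 = (norm x)\<^sup>2 + (norm y)\<^sup>2"
    by (simp add: power2_norm_eq_inner inner_stack)
  also have "\<dots> \<le> (norm x + norm y)\<^sup>2" by (simp add: power2_sum)
  finally show ?thesis by (rule power2_le_imp_le) simp
qed

lemma bounded_linear_xpart: "bounded_linear (xpart :: real ^ ('n::finite + 'p::finite) \<Rightarrow> _)"
  and bounded_linear_ypart: "bounded_linear (ypart :: real ^ ('n::finite + 'p::finite) \<Rightarrow> _)"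
  by (auto intro!: linear_conv_bounded_linear[THEN iffD1] linearI)

lemma bounded_linear_stack:
  "bounded_linear (\<lambda>p. stack (fst p) (snd p) :: real ^ ('n::finite + 'p::finite))"
  by (auto intro!: linear_conv_bounded_linear[THEN iffD1] linearI simp: stack_eq_iff)

lemma diag_block_mult_vec: "diag_block A B *v u = stack (A *v xpart u) (B *v ypart u)"
proof -
  have "(diag_block A B *v u) $ i = stack (A *v xpart u) (B *v ypart u) $ i" for i
    by (cases i) (simp_all add: matrix_vector_mul_component diag_block_def inner_stack)
  then show ?thesis by (simp add: vec_eq_iff)
qed

lemma bounded_linear_diag_block:
  "bounded_linear (\<lambda>p. diag_block (fst p) (snd p) :: real ^ ('n::finite + 'p::finite) ^ ('n + 'p))"
  by (auto intro!: linear_conv_bounded_linear[THEN iffD1] linearI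
      simp: vec_eq_iff diag_block_def stack_def split: sum.splits)

lemma constraint_matrix_mult_vec:
  "constraint_matrix Q *v u =
     stack (matE Q *v xpart u + matF Q *v ypart u) (stack (matC Q *v xpart u) (matD Q *v ypart u))"
proof -
  have "(constraint_matrix Q *v u) $ i =
     stack (matE Q *v xpart u + matF Q *v ypart u) (stack (matC Q *v xpart u) (matD Q *v ypart u)) $ i" for i
    by (simp add: matrix_vector_mul_component constraint_matrix_def inner_stack split: sum.splits)
  then show ?thesis by (simp add: vec_eq_iff)
qed

lemma transpose_constraint_matrix_mult_vec:
  "transpose (constraint_matrix Q) *v v =
     stack (transpose (matE Q) *v xpart v + transpose (matC Q) *v xpart (ypart v))
           (transpose (matF Q) *v xpart v + transpose (matD Q) *v ypart (ypart v))"
proof -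
  have "x \<bullet> (transpose (constraint_matrix Q) *v v) = x \<bullet>
     stack (transpose (matE Q) *v xpart v + transpose (matC Q) *v xpart (ypart v))
           (transpose (matF Q) *v xpart v + transpose (matD Q) *v ypart (ypart v))" for x
    unfolding inner_transpose_vector constraint_matrix_mult_vec
    by (simp only: inner_stack[of "stack _ _"] inner_stack[of _ "stack _ _"] xpart_stack ypart_stack
        inner_add_right inner_add_left inner_transpose_vector)
  then show ?thesis by (rule vector_eq_ldot[THEN iffD1, rule_format])
qed

section \<open>The problem as one polyhedron with signed multipliers\<close>

text \<open>A coupling row never attains \<open>-\<infinity>\<close>, so
  \<open>sign_complementary\<close> forces its multiplier to be nonnegative.\<close>

definition lower_bounds :: "('n::finite, 'p::finite, 'm::finite, 'a::finite, 'b::finite) problem \<Rightarrow> ereal ^ ('m + ('a + 'b))" where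
  "lower_bounds Q = stack (\<chi> i. -\<infinity>) (stack (bndl Q) (bnds Q))"

definition upper_bounds :: "('n::finite, 'p::finite, 'm::finite, 'a::finite, 'b::finite) problem \<Rightarrow> ereal ^ ('m + ('a + 'b))" where
  "upper_bounds Q = stack (to_ereal (vecD Q)) (stack (bndv Q) (bndr Q))"

lemma all_sum_iff: "(\<forall>i::'x + 'y. P i) \<longleftrightarrow> (\<forall>i. P (Inl i)) \<and> (\<forall>j. P (Inr j))"
  by (metis sumE)

lemma feasible_eq_box_polyhedron:
  "feasible Q = box_polyhedron (constraint_matrix Q) (lower_bounds Q) (upper_bounds Q)"
  by (auto simp: feasible_def box_polyhedron_def setX_def setY_def residual_def lower_bounds_def upper_bounds_def
      all_sum_iff constraint_matrix_mult_vec to_ereal_def less_eq_vec_def)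

lemma active_rows_constraint_matrix:
  "active_rows (constraint_matrix Q) (lower_bounds Q) (upper_bounds Q) u =
     act_S Q (xpart u) (ypart u) <+> ((act_l Q (xpart u) \<union> act_v Q (xpart u)) <+>
       (act_s Q (ypart u) \<union> act_r Q (ypart u)))"
  (is "?L = ?R")
proof -
  have "\<forall>i. i \<in> ?L \<longleftrightarrow> i \<in> ?R"
    by (simp add: all_sum_iff active_rows_def act_S_def act_l_def act_v_def act_s_def act_r_def lower_bounds_def
        upper_bounds_def constraint_matrix_mult_vec to_ereal_def residual_def Plus_def image_iff)
  then show ?thesis by blast
qed

lemma complementaryI:
  assumes "\<And>i. 0 \<le> p $ i" "\<And>i. 0 \<le> q $ i" "\<And>i. p $ i \<noteq> 0 \<Longrightarrow> q $ i = 0"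
  shows "complementary p q"
proof -
  have "ereal (p $ i) * q $ i = 0" for i using assms(3)[of i] by (cases "p $ i = 0") auto
  then have "(\<Sum>i\<in>UNIV. ereal (p $ i) * q $ i) = 0" by (rule sum.neutral[rule_format])
  then show ?thesis using assms(1,2) by (simp add: complementary_def)
qed

lemma complementaryD:
  assumes "complementary p q"
  shows "0 \<le> p $ i" "0 \<le> q $ i" "0 < p $ i \<Longrightarrow> q $ i = 0"
proof -
  have nn: "\<And>i. 0 \<le> p $ i" "\<And>i. 0 \<le> q $ i" and s: "(\<Sum>i\<in>UNIV. ereal (p $ i) * q $ i) = 0"
    using assms by (auto simp: complementary_def)
  show "0 \<le> p $ i" "0 \<le> q $ i" using nn by auto
  have "ereal (p $ i) * q $ i = 0"
    using s nn by (subst (asm) sum_nonneg_eq_0_iff) auto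
  then show "0 < p $ i \<Longrightarrow> q $ i = 0" by simp
qed

text \<open>Since \<open>\<alpha>\<close> is nonnegative, a positive difference makes
  \<open>\<gamma> $ i\<close> positive and the upper slack zero; the other sign is symmetric. An
  infinite bound has nonzero slack and drops out.\<close>

lemma kkt_block_multipliers:
  assumes "kkt_block g A C l v x \<mu> \<alpha> \<gamma>"
  shows "0 < (\<gamma> - \<alpha>) $ i \<Longrightarrow> ereal ((C *v x) $ i) = v $ i" "(\<gamma> - \<alpha>) $ i < 0 \<Longrightarrow> ereal ((C *v x) $ i) = l $ i"
proof -
  have c: "complementary \<alpha> (lower_slack C l x)" "complementary \<gamma> (upper_slack C v x)"
    using assms by (auto simp: kkt_block_def)
  have "0 < (\<gamma> - \<alpha>) $ i \<Longrightarrow> upper_slack C v x $ i = 0" "(\<gamma> - \<alpha>) $ i < 0 \<Longrightarrow> lower_slack C l x $ i = 0"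
    using complementaryD[OF c(1), of i] complementaryD[OF c(2), of i] by auto
  then show "0 < (\<gamma> - \<alpha>) $ i \<Longrightarrow> ereal ((C *v x) $ i) = v $ i" "(\<gamma> - \<alpha>) $ i < 0 \<Longrightarrow> ereal ((C *v x) $ i) = l $ i"
    by (cases "v $ i"; cases "l $ i"; simp add: upper_slack_def lower_slack_def)+
qed

definition pos_part :: "real ^ 'k \<Rightarrow> real ^ 'k" where
  "pos_part x = (\<chi> i. max 0 (x $ i))"

lemma kkt_block_of_signed:
  assumes stat: "g + transpose A *v \<mu> + transpose C *v w = 0"
    and bnds: "\<And>i. l $ i \<le> ereal ((C *v x) $ i)" "\<And>i. ereal ((C *v x) $ i) \<le> v $ i"
    and act: "\<And>i. 0 < w $ i \<Longrightarrow> ereal ((C *v x) $ i) = v $ i" "\<And>i. w $ i < 0 \<Longrightarrow> ereal ((C *v x) $ i) = l $ i"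
  shows "kkt_block g A C l v x \<mu> (pos_part (- w)) (pos_part w)"
proof -
  have "pos_part w - pos_part (- w) = w" by (simp add: pos_part_def vec_eq_iff max_def)
  moreover have "complementary (pos_part (- w)) (lower_slack C l x)"
    by (rule complementaryI)
      (auto simp: pos_part_def lower_slack_def bnds ereal_diff_positive max_def act(2)[symmetric] split: if_splits)
  moreover have "complementary (pos_part w) (upper_slack C v x)"
    by (rule complementaryI)
      (auto simp: pos_part_def upper_slack_def bnds ereal_diff_positive max_def act(1)[symmetric] split: if_splits)
  ultimately show ?thesis using stat by (simp add: kkt_block_def)
qed

text \<open>This returns the limit multiplier of the abstract argument to the form in which the
  second-order and strict complementarity hypotheses are stated. Positive and negative parts recover
  the pair of bound multipliers.\<close>

lemma kkt_of_signed:
  assumes u: "u \<in> feasible Q"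
    and stat: "stack (grad (objF Q) (xpart u)) (grad (objTheta Q) (ypart u)) + transpose (constraint_matrix Q) *v v = 0"
    and comp: "sign_complementary (constraint_matrix Q) (lower_bounds Q) (upper_bounds Q) u v"
  shows "kkt Q u (xpart v) (pos_part (- xpart (ypart v))) (pos_part (xpart (ypart v)))
    (pos_part (- ypart (ypart v))) (pos_part (ypart (ypart v)))"
proof -
  have s: "grad (objF Q) (xpart u) + transpose (matE Q) *v xpart v + transpose (matC Q) *v xpart (ypart v) = 0"
    "grad (objTheta Q) (ypart u) + transpose (matF Q) *v xpart v + transpose (matD Q) *v ypart (ypart v) = 0"
    using stat by (simp_all add: transpose_constraint_matrix_mult_vec stack_eq_iff add.assoc del: transpose_matrix_vector)
  have c: "(0 < v $ i \<longrightarrow> ereal ((constraint_matrix Q *v u) $ i) = upper_bounds Q $ i) \<and>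
    (v $ i < 0 \<longrightarrow> ereal ((constraint_matrix Q *v u) $ i) = lower_bounds Q $ i)" for i
    using comp unfolding sign_complementary_def by blast
  note cs = c[unfolded constraint_matrix_mult_vec lower_bounds_def upper_bounds_def]
  have 1: "kkt_block (grad (objF Q) (xpart u)) (matE Q) (matC Q) (bndl Q) (bndv Q) (xpart u)
      (xpart v) (pos_part (- xpart (ypart v))) (pos_part (xpart (ypart v)))"
    using cs[of "Inr (Inl _)"] u by (intro kkt_block_of_signed s) (auto simp: feasible_def setX_def xpart_nth ypart_nth)
  have 2: "kkt_block (grad (objTheta Q) (ypart u)) (matF Q) (matD Q) (bnds Q) (bndr Q) (ypart u)
      (xpart v) (pos_part (- ypart (ypart v))) (pos_part (ypart (ypart v)))"
    using cs[of "Inr (Inr _)"] u by (intro kkt_block_of_signed s) (auto simp: feasible_def setY_def ypart_nth)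
  have nn: "0 \<le> xpart v $ i" for i using cs[of "Inl i"] by (auto simp: xpart_nth not_less[symmetric])
  have "complementary (xpart v) (to_ereal (- residual Q (xpart u) (ypart u)))"
  proof (rule complementaryI)
    fix i
    show "0 \<le> to_ereal (- residual Q (xpart u) (ypart u)) $ i"
      using u by (simp add: feasible_def to_ereal_def less_eq_vec_def)
    assume "xpart v $ i \<noteq> 0"
    with nn[of i] cs[of "Inl i"] show "to_ereal (- residual Q (xpart u) (ypart u)) $ i = 0"
      by (simp add: xpart_nth to_ereal_def residual_def)
  qed (rule nn)
  with 1 2 show ?thesis by (simp add: kkt_def)
qed

text \<open>Consequently a vector annihilated by all rows with nonzero signed multiplier lies in the
  kernel used by \<open>strong_sosc\<close>.\<close>

lemma strongly_active_nonzero: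
  assumes "i \<in> strongly_active Q u (xpart v) (pos_part (- xpart (ypart v))) (pos_part (xpart (ypart v)))
    (pos_part (- ypart (ypart v))) (pos_part (ypart (ypart v)))"
  shows "v $ i \<noteq> 0"
  using assms by (auto simp: strongly_active_def Let_def pos_part_def xpart_nth ypart_nth max_def split: if_splits)

lemma strict_complementarity_nonzero:
  assumes "strict_complementarity Q u (xpart v) (pos_part (- xpart (ypart v))) (pos_part (xpart (ypart v)))
    (pos_part (- ypart (ypart v))) (pos_part (ypart (ypart v)))"
    and "i \<in> active_rows (constraint_matrix Q) (lower_bounds Q) (upper_bounds Q) u"
  shows "v $ i \<noteq> 0"
proof -
  have m: "0 < v $ Inl i" if "i \<in> act_S Q (xpart u) (ypart u)" for i
    using assms(1) that by (simp add: strict_complementarity_def Let_def xpart_nth)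
  have a: "v $ Inr (Inl i) \<noteq> 0" if "i \<in> act_l Q (xpart u) \<union> act_v Q (xpart u)" for i
    using assms(1) that
    by (auto simp: strict_complementarity_def Let_def pos_part_def xpart_nth ypart_nth)
  have b: "v $ Inr (Inr i) \<noteq> 0" if "i \<in> act_s Q (ypart u) \<union> act_r Q (ypart u)" for i
    using assms(1) that
    by (auto simp: strict_complementarity_def Let_def pos_part_def ypart_nth)
  from assms(2) consider j where "i = Inl j" "j \<in> act_S Q (xpart u) (ypart u)"
    | j where "i = Inr (Inl j)" "j \<in> act_l Q (xpart u) \<union> act_v Q (xpart u)"
    | j where "i = Inr (Inr j)" "j \<in> act_s Q (ypart u) \<union> act_r Q (ypart u)"
    unfolding active_rows_constraint_matrix by (elim PlusE) blast+
  then show ?thesis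
  proof cases
    case (1 j) then show ?thesis using m[of j] by simp
  next
    case (2 j) then show ?thesis using a[of j] by simp
  next
    case (3 j) then show ?thesis using b[of j] by simp
  qed
qed

section \<open>Derivatives of the separable objective\<close>

lemma grad_eq:
  assumes "(f has_derivative (\<lambda>h. D \<bullet> h)) (at x)"
  shows "grad f x = D"
  unfolding grad_def gderiv_def
proof (rule the_equality)
  show "(f has_derivative (\<lambda>h. h \<bullet> D)) (at x)" using assms by (simp add: inner_commute)
  fix D' assume "(f has_derivative (\<lambda>h. h \<bullet> D')) (at x)"
  from has_derivative_unique[OF this assms] have "\<forall>h. h \<bullet> D' = h \<bullet> D" by (metis inner_commute)
  then show "D' = D" by (simp only: vector_eq_ldot)
qed

text \<open>The Riesz representative of the derivative is its adjoint applied to 1.\<close>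

lemma has_derivative_grad:
  assumes "f differentiable (at x)"
  shows "(f has_derivative (\<lambda>h. grad f x \<bullet> h)) (at x)"
proof -
  obtain f' where f': "(f has_derivative f') (at x)" using assms by (auto simp: differentiable_def)
  have "f' = (\<lambda>h. adjoint f' 1 \<bullet> h)"
    using adjoint_works[OF has_derivative_linear[OF f'], of _ 1] by (auto simp: inner_commute)
  with f' have "(f has_derivative (\<lambda>h. adjoint f' 1 \<bullet> h)) (at x)" by simp
  with grad_eq[OF this] show ?thesis by simp
qed

lemma has_derivative_Phi:
  assumes "valid_problem Q"
  shows "(Phi Q has_derivative (\<lambda>h. stack (grad (objF Q) (xpart u)) (grad (objTheta Q) (ypart u)) \<bullet> h)) (at u)"
proof -
  have f: "(objF Q has_derivative (\<lambda>h. grad (objF Q) x \<bullet> h)) (at x)" for x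
    using assms by (intro has_derivative_grad) (auto simp: valid_problem_def C1_on_def)
  have th: "(objTheta Q has_derivative (\<lambda>h. grad (objTheta Q) y \<bullet> h)) (at y)" for y
    using assms by (intro has_derivative_grad) (auto simp: valid_problem_def C1_on_def)
  have "((\<lambda>u. objF Q (xpart u) + objTheta Q (ypart u)) has_derivative
      (\<lambda>h. grad (objF Q) (xpart u) \<bullet> xpart h + grad (objTheta Q) (ypart u) \<bullet> ypart h)) (at u)"
    by (intro has_derivative_add
        has_derivative_compose[OF bounded_linear_imp_has_derivative[OF bounded_linear_xpart] f]
        has_derivative_compose[OF bounded_linear_imp_has_derivative[OF bounded_linear_ypart] th])
  then show ?thesis by (simp add: Phi_def[abs_def] inner_stack)
qed

lemma grad_Phi:
  assumes "valid_problem Q"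
  shows "grad (Phi Q) = (\<lambda>u. stack (grad (objF Q) (xpart u)) (grad (objTheta Q) (ypart u)))"
  by (intro ext grad_eq has_derivative_Phi assms)

lemma continuous_grad_Phi:
  assumes "valid_problem Q"
  shows "continuous_on UNIV (grad (Phi Q))"
proof -
  have c: "continuous_on UNIV (grad (objF Q))" "continuous_on UNIV (grad (objTheta Q))"
    using assms by (auto simp: valid_problem_def C1_on_def)
  have "continuous_on UNIV (\<lambda>u. (grad (objF Q) (xpart u), grad (objTheta Q) (ypart u)))"
    by (intro continuous_intros continuous_on_compose2[OF c(1)] continuous_on_compose2[OF c(2)]
        linear_continuous_on bounded_linear_xpart bounded_linear_ypart) auto
  from continuous_on_compose2[OF linear_continuous_on[OF bounded_linear_stack, of UNIV] this]
  show ?thesis by (simp add: grad_Phi[OF assms])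
qed

lemma has_derivative_grad_Phi:
  assumes "valid_problem Q" "C2_on U (objF Q)" "C2_on V (objTheta Q)" "xpart u \<in> U" "ypart u \<in> V"
  shows "(grad (Phi Q) has_derivative
      (\<lambda>h. diag_block (hessian (objF Q) (xpart u)) (hessian (objTheta Q) (ypart u)) *v h)) (at u)"
proof -
  have f: "(grad (objF Q) has_derivative (\<lambda>h. hessian (objF Q) (xpart u) *v h)) (at (xpart u))"
    using assms unfolding hessian_def by (auto simp: C2_on_def simp flip: jacobian_works)
  have th: "(grad (objTheta Q) has_derivative (\<lambda>h. hessian (objTheta Q) (ypart u) *v h)) (at (ypart u))"
    using assms unfolding hessian_def by (auto simp: C2_on_def simp flip: jacobian_works)
  have "((\<lambda>u. (grad (objF Q) (xpart u), grad (objTheta Q) (ypart u))) has_derivative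
      (\<lambda>h. (hessian (objF Q) (xpart u) *v xpart h, hessian (objTheta Q) (ypart u) *v ypart h))) (at u)"
    by (intro has_derivative_Pair
        has_derivative_compose[OF bounded_linear_imp_has_derivative[OF bounded_linear_xpart] f]
        has_derivative_compose[OF bounded_linear_imp_has_derivative[OF bounded_linear_ypart] th])
  from has_derivative_compose[OF this bounded_linear_imp_has_derivative[OF bounded_linear_stack]]
  show ?thesis by (simp add: grad_Phi[OF assms(1)] diag_block_mult_vec)
qed

lemma hessian_Phi:
  assumes "valid_problem Q" "C2_on U (objF Q)" "C2_on V (objTheta Q)" "xpart u \<in> U" "ypart u \<in> V"
  shows "hessian (Phi Q) u = diag_block (hessian (objF Q) (xpart u)) (hessian (objTheta Q) (ypart u))"
  by (simp add: hessian_def[of "Phi Q"] jacobian_def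
      flip: frechet_derivative_at[OF has_derivative_grad_Phi[OF assms]])

lemma continuous_hessian_Phi:
  assumes "valid_problem Q" "C2_on U (objF Q)" "C2_on V (objTheta Q)"
  shows "continuous_on {u. xpart u \<in> U \<and> ypart u \<in> V} (hessian (Phi Q))"
proof -
  have c: "continuous_on U (hessian (objF Q))" "continuous_on V (hessian (objTheta Q))"
    using assms by (auto simp: C2_on_def)
  have "continuous_on {u. xpart u \<in> U \<and> ypart u \<in> V} (\<lambda>u. (hessian (objF Q) (xpart u), hessian (objTheta Q) (ypart u)))"
    by (intro continuous_intros continuous_on_compose2[OF c(1)] continuous_on_compose2[OF c(2)]
        linear_continuous_on bounded_linear_xpart bounded_linear_ypart) auto
  from continuous_on_compose2[OF linear_continuous_on[OF bounded_linear_diag_block, of UNIV] this]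
  have "continuous_on {u. xpart u \<in> U \<and> ypart u \<in> V}
      (\<lambda>u. diag_block (hessian (objF Q) (xpart u)) (hessian (objTheta Q) (ypart u)))" by simp
  then show ?thesis by (rule continuous_on_eq) (use hessian_Phi[OF assms] in auto)
qed

section \<open>The trial steps\<close>

lemma residual_shift:
  "residual Q x' y' $ i = residual Q x y $ i + (matE Q *v (x' - x)) $ i + (matF Q *v (y' - y)) $ i"
  by (simp add: residual_def matrix_vector_mult_diff_distrib)

text \<open>In Step 1 each block may raise a coupling row by at most minus half its residual, so
  both together stay feasible. Where a multiplier is positive, this allowance is used up and the
  change of its block is nonnegative; lowering both multipliers to their minimum can then only
  decrease the sum in the last claim. In Step 3 the multipliers agree and that claim is an
  equality.\<close>

lemma trial_properties:
  assumes u: "u \<in> feasible Q" and w: "step1 Q u Hx Hy w \<or> step3 Q u Hx Hy w"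
  shows "stack (trX w) (trY w) \<in> feasible Q"
    "kkt_block (model_grad (objF Q) Hx (xpart u) (trX w)) (matE Q) (matC Q) (bndl Q) (bndv Q) (trX w)
       (muX w) (alphaX w) (gammaX w)"
    "kkt_block (model_grad (objTheta Q) Hy (ypart u) (trY w)) (matF Q) (matD Q) (bnds Q) (bndr Q) (trY w)
       (muY w) (alphaY w) (gammaY w)"
    "0 \<le> muX w $ i" "0 \<le> muY w $ i"
    "0 < muX w $ i \<Longrightarrow> 0 < muY w $ i \<Longrightarrow> residual Q (trX w) (trY w) $ i = 0"
    "min (muX w $ i) (muY w $ i) * ((matE Q *v (trX w - xpart u)) $ i + (matF Q *v (trY w - ypart u)) $ i)
      \<le> muX w $ i * (matE Q *v (trX w - xpart u)) $ i + muY w $ i * (matF Q *v (trY w - ypart u)) $ i"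
proof -
  show "kkt_block (model_grad (objF Q) Hx (xpart u) (trX w)) (matE Q) (matC Q) (bndl Q) (bndv Q) (trX w)
       (muX w) (alphaX w) (gammaX w)"
    "kkt_block (model_grad (objTheta Q) Hy (ypart u) (trY w)) (matF Q) (matD Q) (bnds Q) (bndr Q) (trY w)
       (muY w) (alphaY w) (gammaY w)"
    using w by (auto simp: step1_def step3_def Let_def)
  let ?h = "residual Q (xpart u) (ypart u)"
  let ?e = "matE Q *v (trX w - xpart u)" and ?f = "matF Q *v (trY w - ypart u)"
  have h: "?h $ j \<le> 0" for j using u by (simp add: feasible_def less_eq_vec_def)
  have r: "residual Q (trX w) (trY w) $ j = ?h $ j + ?e $ j + ?f $ j" for j by (rule residual_shift)
  have "stack (trX w) (trY w) \<in> feasible Q \<and> 0 \<le> muX w $ i \<and> 0 \<le> muY w $ i \<and>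
    (0 < muX w $ i \<longrightarrow> 0 < muY w $ i \<longrightarrow> residual Q (trX w) (trY w) $ i = 0) \<and>
    min (muX w $ i) (muY w $ i) * (?e $ i + ?f $ i) \<le> muX w $ i * ?e $ i + muY w $ i * ?f $ i"
    using w
  proof
    assume s: "step1 Q u Hx Hy w"
    have rx: "residual Q (trX w) (ypart u) $ j = ?h $ j + ?e $ j" for j
      using residual_shift[of Q "trX w" "ypart u" j "xpart u" "ypart u"] by simp
    have ry: "residual Q (xpart u) (trY w) $ j = ?h $ j + ?f $ j" for j
      using residual_shift[of Q "xpart u" "trY w" j "xpart u" "ypart u"] by simp
    have cx: "complementary (muX w) (to_ereal ((1/2) *\<^sub>R ?h - residual Q (trX w) (ypart u)))"
      and cy: "complementary (muY w) (to_ereal ((1/2) *\<^sub>R ?h - residual Q (xpart u) (trY w)))"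
      and mem: "trX w \<in> setX Q" "trY w \<in> setY Q"
      using s by (auto simp: step1_def Let_def is_arg_min_def)
    have X: "0 \<le> muX w $ j" "?e $ j \<le> - ?h $ j / 2" "0 < muX w $ j \<Longrightarrow> ?e $ j = - ?h $ j / 2" for j
      using complementaryD[OF cx, of j] by (auto simp: to_ereal_def rx)
    have Y: "0 \<le> muY w $ j" "?f $ j \<le> - ?h $ j / 2" "0 < muY w $ j \<Longrightarrow> ?f $ j = - ?h $ j / 2" for j
      using complementaryD[OF cy, of j] by (auto simp: to_ereal_def ry)
    have "residual Q (trX w) (trY w) $ j \<le> 0" for j
      using X(2)[of j] Y(2)[of j] r[of j] by simp
    then have "stack (trX w) (trY w) \<in> feasible Q"
      using mem by (simp add: feasible_def less_eq_vec_def)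
    moreover have "residual Q (trX w) (trY w) $ i = 0" if "0 < muX w $ i" "0 < muY w $ i"
      using X(3)[OF that(1)] Y(3)[OF that(2)] r[of i] by simp
    moreover have "min (muX w $ i) (muY w $ i) * (?e $ i + ?f $ i) \<le> muX w $ i * ?e $ i + muY w $ i * ?f $ i"
    proof -
      consider "muX w $ i = 0" | "muY w $ i = 0" | "0 < muX w $ i" "0 < muY w $ i"
        using X(1)[of i] Y(1)[of i] by fastforce
      then show ?thesis
      proof cases
        case 1
        have "0 \<le> muY w $ i * ?f $ i"
          using Y(1)[of i] Y(3)[of i] h[of i] by (cases "0 < muY w $ i") (simp_all add: mult_nonneg_nonpos)
        with 1 Y(1)[of i] show ?thesis by simp
      next
        case 2
        have "0 \<le> muX w $ i * ?e $ i"
          using X(1)[of i] X(3)[of i] h[of i] by (cases "0 < muX w $ i") (simp_all add: mult_nonneg_nonpos)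
        with 2 X(1)[of i] show ?thesis by simp
      next
        case 3
        then have "0 \<le> ?e $ i" "0 \<le> ?f $ i" using X(3)[of i] Y(3)[of i] h[of i] by auto
        then show ?thesis by (simp add: distrib_left add_mono mult_right_mono)
      qed
    qed
    ultimately show ?thesis using X(1) Y(1) by blast
  next
    assume s: "step3 Q u Hx Hy w"
    have c: "complementary (muX w) (to_ereal (- residual Q (trX w) (trY w)))"
      and mem: "trX w \<in> setX Q" "trY w \<in> setY Q" "residual Q (trX w) (trY w) \<le> 0"
      and eq: "muX w = muY w"
      using s by (auto simp: step3_def Let_def is_arg_min_def)
    then show ?thesis
      using complementaryD[OF c, of i] by (auto simp: feasible_def to_ereal_def algebra_simps)
  qed
  then show "stack (trX w) (trY w) \<in> feasible Q" "0 \<le> muX w $ i" "0 \<le> muY w $ i"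
    "0 < muX w $ i \<Longrightarrow> 0 < muY w $ i \<Longrightarrow> residual Q (trX w) (trY w) $ i = 0"
    "min (muX w $ i) (muY w $ i) * (?e $ i + ?f $ i) \<le> muX w $ i * ?e $ i + muY w $ i * ?f $ i"
    by blast+
qed

text \<open>In Step 1 the two multipliers of the coupling constraint differ. Their componentwise minimum is positive
  only where both half-step constraints are active, hence only where the coupling constraint is active at
  the trial point, so that complementarity holds exactly and the error moves to stationarity.\<close>

definition signed_multiplier ::
  "('n::finite, 'p::finite, 'm::finite, 'a::finite, 'b::finite) trial \<Rightarrow> real ^ ('m + ('a + 'b))" where
  "signed_multiplier w =
     stack (\<chi> i. min (muX w $ i) (muY w $ i)) (stack (gammaX w - alphaX w) (gammaY w - alphaY w))"

lemma direction_parts [simp]: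
  "u + direction u w = stack (trX w) (trY w)"
  "xpart (direction u w) = trX w - xpart u" "ypart (direction u w) = trY w - ypart u"
  by (simp_all add: direction_def)

lemma signed_multiplier_complementary:
  assumes u: "u \<in> feasible Q" and w: "step1 Q u Hx Hy w \<or> step3 Q u Hx Hy w"
  shows "sign_complementary (constraint_matrix Q) (lower_bounds Q) (upper_bounds Q)
    (stack (trX w) (trY w)) (signed_multiplier w)"
proof -
  note tp = trial_properties[OF u w]
  have "residual Q (trX w) (trY w) $ i = 0" if "0 < min (muX w $ i) (muY w $ i)" for i
    using tp(6) that by simp
  moreover have "\<not> min (muX w $ i) (muY w $ i) < 0" for i
    using tp(4,5)[of i] by (simp add: not_less)
  ultimately show ?thesis
    using kkt_block_multipliers[OF tp(2)] kkt_block_multipliers[OF tp(3)]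
    unfolding sign_complementary_def all_sum_iff
    by (simp add: constraint_matrix_mult_vec signed_multiplier_def lower_bounds_def upper_bounds_def
        to_ereal_def residual_def)
qed

lemma add_insert_eq_diff:
  fixes a b c e m :: "'z::ab_group_add"
  assumes "a + b + c = - e"
  shows "a + b + (m + c) = m - e"
proof -
  have "a + b + (m + c) = m + (a + b + c)" by (simp add: ac_simps)
  then show ?thesis by (simp add: assms)
qed

text \<open>Replacing both multipliers by their minimum \<open>m\<close> is the only perturbation of
  the two stationarity equations, and componentwise \<open>m\<close> differs from either by at most
  their gap.\<close>

lemma signed_multiplier_stationary:
  assumes vp: "valid_problem Q" and u: "u \<in> feasible Q" and w: "step1 Q u Hx Hy w \<or> step3 Q u Hx Hy w"
  shows "norm (grad (Phi Q) u + diag_block Hx Hy *v direction u w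
      + transpose (constraint_matrix Q) *v signed_multiplier w)
    \<le> (norm (transpose (matE Q)) + norm (transpose (matF Q))) * norm (muX w - muY w)"
proof -
  note tp = trial_properties[OF u w]
  define m where "m = (\<chi> i. min (muX w $ i) (muY w $ i))"
  have X: "grad (objF Q) (xpart u) + Hx *v (trX w - xpart u) + transpose (matC Q) *v (gammaX w - alphaX w)
      = - (transpose (matE Q) *v muX w)"
    using tp(2) unfolding kkt_block_def model_grad_def by (simp only: eq_neg_iff_add_eq_0) (simp only: ac_simps)
  have Y: "grad (objTheta Q) (ypart u) + Hy *v (trY w - ypart u) + transpose (matD Q) *v (gammaY w - alphaY w)
      = - (transpose (matF Q) *v muY w)"
    using tp(3) unfolding kkt_block_def model_grad_def by (simp only: eq_neg_iff_add_eq_0) (simp only: ac_simps)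
  have "grad (Phi Q) u + diag_block Hx Hy *v direction u w + transpose (constraint_matrix Q) *v signed_multiplier w
      = stack (transpose (matE Q) *v (m - muX w)) (transpose (matF Q) *v (m - muY w))"
    unfolding grad_Phi[OF vp] diag_block_mult_vec transpose_constraint_matrix_mult_vec stack_eq_iff
      signed_multiplier_def m_def[symmetric] direction_parts xpart_simps xpart_stack ypart_stack
      matrix_vector_mult_diff_distrib[of _ m]
    by (intro conjI add_insert_eq_diff X Y)
  also have "norm \<dots> \<le> norm (transpose (matE Q) *v (m - muX w)) + norm (transpose (matF Q) *v (m - muY w))"
    by (rule norm_stack_le)
  also have "\<dots> \<le> norm (transpose (matE Q)) * norm (muX w - muY w) + norm (transpose (matF Q)) * norm (muX w - muY w)"
  proof (intro add_mono order_trans[OF norm_matrix_vector_mult_le] mult_left_mono)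
    show "norm (m - muX w) \<le> norm (muX w - muY w)" "norm (m - muY w) \<le> norm (muX w - muY w)"
      by (rule norm_le_componentwise_cart; simp add: m_def min_def)+
  qed auto
  finally show ?thesis by (simp add: distrib_right)
qed

text \<open>Pairing the perturbed stationarity with \<open>d\<close> would leave an error term.
  Instead each block is paired with its own exact equation, and only afterwards are the multipliers
  lowered to their minimum. The descent inequality thus holds at every iteration, as the line search
  argument requires.\<close>

lemma signed_multiplier_descent:
  assumes vp: "valid_problem Q" and u: "u \<in> feasible Q" and w: "step1 Q u Hx Hy w \<or> step3 Q u Hx Hy w"
  defines "d \<equiv> direction u w"
  shows "grad (Phi Q) u \<bullet> d + d \<bullet> (diag_block Hx Hy *v d)
    \<le> - (\<Sum>i\<in>UNIV. signed_multiplier w $ i * (constraint_matrix Q *v d) $ i)"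
proof -
  note tp = trial_properties[OF u w]
  define dx where "dx = trX w - xpart u"
  define dy where "dy = trY w - ypart u"
  have X: "dx \<bullet> (grad (objF Q) (xpart u) + Hx *v dx + transpose (matE Q) *v muX w
      + transpose (matC Q) *v (gammaX w - alphaX w)) = 0"
    using tp(2) unfolding kkt_block_def model_grad_def dx_def[symmetric] by simp
  have Y: "dy \<bullet> (grad (objTheta Q) (ypart u) + Hy *v dy + transpose (matF Q) *v muY w
      + transpose (matD Q) *v (gammaY w - alphaY w)) = 0"
    using tp(3) unfolding kkt_block_def model_grad_def dy_def[symmetric] by simp
  have "grad (Phi Q) u \<bullet> d + d \<bullet> (diag_block Hx Hy *v d) =
      dx \<bullet> grad (objF Q) (xpart u) + dy \<bullet> grad (objTheta Q) (ypart u) + dx \<bullet> (Hx *v dx) + dy \<bullet> (Hy *v dy)"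
    unfolding d_def diag_block_mult_vec grad_Phi[OF vp] inner_stack[of "direction u w"]
      inner_stack[of _ "direction u w"]
    by (simp add: dx_def dy_def inner_commute)
  also have "\<dots> = - ((matE Q *v dx) \<bullet> muX w + (matF Q *v dy) \<bullet> muY w)
      - (matC Q *v dx) \<bullet> (gammaX w - alphaX w) - (matD Q *v dy) \<bullet> (gammaY w - alphaY w)"
    using X Y unfolding inner_add_right inner_transpose_vector by linarith
  also have "\<dots> \<le> - (\<Sum>i\<in>UNIV. min (muX w $ i) (muY w $ i) * (matE Q *v dx + matF Q *v dy) $ i)
      - (matC Q *v dx) \<bullet> (gammaX w - alphaX w) - (matD Q *v dy) \<bullet> (gammaY w - alphaY w)"
  proof -
    have "(\<Sum>i\<in>UNIV. min (muX w $ i) (muY w $ i) * (matE Q *v dx + matF Q *v dy) $ i)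
        \<le> (\<Sum>i\<in>UNIV. muX w $ i * (matE Q *v dx) $ i + muY w $ i * (matF Q *v dy) $ i)"
      using tp(7) by (intro sum_mono) (simp add: dx_def dy_def)
    also have "\<dots> = (matE Q *v dx) \<bullet> muX w + (matF Q *v dy) \<bullet> muY w"
      by (simp add: inner_vec_def sum.distrib mult.commute)
    finally show ?thesis by simp
  qed
  also have "\<dots> = - (\<Sum>i\<in>UNIV. signed_multiplier w $ i * (constraint_matrix Q *v d) $ i)"
    by (simp add: constraint_matrix_mult_vec d_def signed_multiplier_def inner_vec_def sum.Plus
        dx_def[symmetric] dy_def[symmetric] mult.commute flip: UNIV_Plus_UNIV)
  finally show ?thesis .
qed

definition projection_rows ::
  "bool \<Rightarrow> ('n::finite, 'p::finite, 'm::finite, 'a::finite, 'b::finite) problem \<Rightarrow> real ^ ('n + 'p) \<Rightarrow>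
   ('n, 'p, 'm, 'a, 'b) trial \<Rightarrow> ('m + ('a + 'b)) set" where
  "projection_rows from_step1 Q u w =
     (if from_step1
      then {i. (residual Q (trX w) (ypart u) - (1/2) *\<^sub>R residual Q (xpart u) (ypart u)) $ i = 0} \<inter>
           {i. (residual Q (xpart u) (trY w) - (1/2) *\<^sub>R residual Q (xpart u) (ypart u)) $ i = 0}
      else act_S Q (trX w) (trY w)) <+>
     ((act_l Q (trX w) \<union> act_v Q (trX w)) <+> (act_s Q (trY w) \<union> act_r Q (trY w)))"

lemma projection_matrix_eq:
  "projection_matrix b Q u w = null_projection (projection_rows b Q u w) (constraint_matrix Q)"
  by (simp add: projection_matrix_def projection_rows_def Let_def)

text \<open>The two half-step residuals, each reduced by half the current residual, sum to the
  coupling residual at the trial point.\<close>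

lemma projection_rows_active:
  "projection_rows b Q u w \<subseteq>
     active_rows (constraint_matrix Q) (lower_bounds Q) (upper_bounds Q) (stack (trX w) (trY w))"
proof -
  have "residual Q (trX w) (trY w) $ i = 0"
    if "(residual Q (trX w) (ypart u) - (1/2) *\<^sub>R residual Q (xpart u) (ypart u)) $ i = 0"
       "(residual Q (xpart u) (trY w) - (1/2) *\<^sub>R residual Q (xpart u) (ypart u)) $ i = 0" for i
    using that by (simp add: residual_def)
  then show ?thesis
    unfolding projection_rows_def active_rows_constraint_matrix xpart_stack ypart_stack
    by (auto simp: act_S_def Plus_def split: if_splits)
qed

theorem theorem4p4:
  fixes Q :: "('n::finite, 'p::finite, 'm::finite, 'a::finite, 'b::finite) problem"
    and \<rho> \<sigma> \<tau>1 M M1 \<eta> :: real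
    and u :: "nat \<Rightarrow> real ^ ('n + 'p)"
    and Hx :: "nat \<Rightarrow> real ^ 'n ^ 'n" and Hy :: "nat \<Rightarrow> real ^ 'p ^ 'p"
    and w1 w :: "nat \<Rightarrow> ('n, 'p, 'm, 'a, 'b) trial"
    and t :: "nat \<Rightarrow> real"
    and H P :: "nat \<Rightarrow> real ^ ('n + 'p) ^ ('n + 'p)"
    and d :: "nat \<Rightarrow> real ^ ('n + 'p)"
  assumes H_eq: "\<And>k. H k = diag_block (Hx k) (Hy k)"
    and d_eq: "\<And>k. d k = direction (u k) (w k)"
    and P_eq: "\<And>k. P k = projection_matrix (step2_accepts M M1 \<tau>1 (u k) (w1 k)) Q (u k) (w k)"
    and problem: "valid_problem Q"
    and params: "0 < \<rho>" "\<rho> < 1/2" "0 < \<sigma>" "\<sigma> < 1" "1 < \<tau>1" "0 < M" "0 < M1"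
    and run: "infinite_run Q \<rho> \<sigma> \<tau>1 M M1 u Hx Hy w1 w t"
    and eta: "0 < \<eta>" "\<And>k. pos_semidef (H k - \<eta> *\<^sub>R mat 1)"
    and H_bounded: "\<And>r :: nat \<Rightarrow> nat. strict_mono r \<Longrightarrow> bounded (range (u \<circ> r)) \<Longrightarrow> bounded (range (H \<circ> r))"
    and smooth: "\<exists>U V. open U \<and> open V \<and> xpart ` feasible Q \<subseteq> U \<and> ypart ` feasible Q \<subseteq> V \<and>
                   C2_on U (objF Q) \<and> C2_on V (objTheta Q)"
    and u_bounded: "bounded (range u)"
    and licq: "\<And>a. accumulation_point u a \<Longrightarrow> licq Q a"
    and sosc: "\<And>a \<mu> \<alpha>x \<gamma>x \<alpha>y \<gamma>y. accumulation_point u a \<Longrightarrow> kkt Q a \<mu> \<alpha>x \<gamma>x \<alpha>y \<gamma>y \<Longrightarrow>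
                 strong_sosc Q a \<mu> \<alpha>x \<gamma>x \<alpha>y \<gamma>y"
    and hess_approx:
      "(\<lambda>k. norm ((H k - hessian (Phi Q) (u k)) *v d k)) \<in> o(\<lambda>k. norm (d k)) \<or>
       (\<lambda>k. norm (P k *v ((H k - hessian (Phi Q) (u k)) *v d k))) \<in> o(\<lambda>k. norm (d k)) \<and>
       (\<forall>a \<mu> \<alpha>x \<gamma>x \<alpha>y \<gamma>y. accumulation_point u a \<and> kkt Q a \<mu> \<alpha>x \<gamma>x \<alpha>y \<gamma>y \<longrightarrow>
          strict_complementarity Q a \<mu> \<alpha>x \<gamma>x \<alpha>y \<gamma>y)"
  shows "\<exists>ustar. u \<longlonglongrightarrow> ustar \<and>
           (\<lambda>k. norm (u (Suc k) - ustar)) \<in> o(\<lambda>k. norm (u k - ustar))"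
proof -
  let ?A = "constraint_matrix Q" and ?L = "lower_bounds Q" and ?U = "upper_bounds Q"
  let ?v = "\<lambda>k. (H k - hessian (Phi Q) (u k)) *v d k"
  obtain U V where UV: "open U" "open V" "xpart ` feasible Q \<subseteq> U" "ypart ` feasible Q \<subseteq> V"
    and C2: "C2_on U (objF Q)" "C2_on V (objTheta Q)"
    using smooth by blast
  define W where "W = {u :: real ^ ('n + 'p). xpart u \<in> U \<and> ypart u \<in> V}"
  have "W = xpart -` U \<inter> ypart -` V" by (auto simp: W_def)
  then have W: "open W" "box_polyhedron ?A ?L ?U \<subseteq> W"
    using UV by (auto intro!: open_Int open_vimage linear_continuous_on bounded_linear_xpart bounded_linear_ypart
        simp: feasible_eq_box_polyhedron)
  have deriv2: "(grad (Phi Q) has_derivative (\<lambda>h. hessian (Phi Q) x *v h)) (at x)" if "x \<in> W" for x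
    using has_derivative_grad_Phi[OF problem C2, of x] hessian_Phi[OF problem C2, of x] that by (simp add: W_def)
  have hess_cont: "continuous_on W (hessian (Phi Q))"
    unfolding W_def by (rule continuous_hessian_Phi[OF problem C2])
  have u0: "u 0 \<in> feasible Q"
    and s1: "\<And>k. step1 Q (u k) (Hx k) (Hy k) (w1 k)"
    and sw: "\<And>k. if step2_accepts M M1 \<tau>1 (u k) (w1 k) then w k = w1 k else step3 Q (u k) (Hx k) (Hy k) (w k)"
    and ls: "\<And>k. line_search Q \<rho> \<sigma> (H k) (u k) (d k) (t k)"
    and upd: "\<And>k. u (Suc k) = u k + t k *\<^sub>R d k"
    using run unfolding infinite_run_def H_eq d_eq by auto
  have step: "step1 Q (u k) (Hx k) (Hy k) (w k) \<or> step3 Q (u k) (Hx k) (Hy k) (w k)" for k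
    using s1[of k] sw[of k] by (auto split: if_splits)
  have gap: "norm (muX (w k) - muY (w k)) \<le> M1 * norm (d k) powr \<tau>1" for k
  proof (cases "step2_accepts M M1 \<tau>1 (u k) (w1 k)")
    case True
    with sw[of k] have "w k = w1 k" by simp
    with True show ?thesis by (simp add: step2_accepts_def d_eq)
  next
    case False
    with sw[of k] have "muX (w k) = muY (w k)" by (simp add: step3_def Let_def)
    then show ?thesis using params by simp
  qed
  have power: "\<exists>i. t k = \<sigma> ^ i"
    and armijo: "Phi Q (u k + t k *\<^sub>R d k) \<le> Phi Q (u k) - \<rho> * t k * (d k \<bullet> (H k *v d k))"
    and maximal: "\<And>i. Phi Q (u k + \<sigma> ^ i *\<^sub>R d k) \<le> Phi Q (u k) - \<rho> * \<sigma> ^ i * (d k \<bullet> (H k *v d k)) \<Longrightarrow>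
      \<sigma> ^ i \<le> t k" for k
    using ls[of k] unfolding line_search_def Let_def sq_norm_def by blast+
  have feas: "u k \<in> feasible Q" for k
  proof (induction k)
    case (Suc k)
    have "0 \<le> t k" "t k \<le> 1" using power[of k] params by (auto simp: power_le_one)
    moreover have "u k + d k \<in> feasible Q" using trial_properties(1)[OF Suc step] by (simp add: d_eq)
    ultimately show ?case
      using Suc unfolding upd feasible_eq_box_polyhedron by (intro convex_combination_box_polyhedron)
  qed (rule u0)
  have coercive: "\<eta> * (norm z)\<^sup>2 \<le> z \<bullet> (H k *v z)" for k z
  proof -
    have "0 \<le> z \<bullet> ((H k - \<eta> *\<^sub>R mat 1) *v z)"
      using eta(2)[of k] unfolding pos_semidef_def sq_norm_def by blast
    then show ?thesis
      by (simp add: matrix_vector_mult_diff_rdistrib inner_diff_right scaleR_matrix_vector_assoc[symmetric]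
          power2_norm_eq_inner)
  qed
  \<comment> \<open>The whole sequence is bounded, so the subsequence hypothesis applies with
    \<open>id\<close>.\<close>
  have Hb: "bounded (range H)" using H_bounded[of id] u_bounded by (simp add: strict_mono_id)
  have kkt: "kkt Q a (xpart l) (pos_part (- xpart (ypart l))) (pos_part (xpart (ypart l)))
      (pos_part (- ypart (ypart l))) (pos_part (ypart (ypart l)))"
    if "a \<in> box_polyhedron ?A ?L ?U" "grad (Phi Q) a + transpose ?A *v l = 0" "sign_complementary ?A ?L ?U a l"
    for a l
    using that by (intro kkt_of_signed) (simp_all add: feasible_eq_box_polyhedron grad_Phi[OF problem])
  have lq: "l = 0" if "accumulation_point u a" "\<And>i. i \<notin> active_rows ?A ?L ?U a \<Longrightarrow> l $ i = 0"
    "transpose ?A *v l = 0" for a l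
    using licq[OF that(1)] that(2,3) unfolding licq_def Let_def active_rows_constraint_matrix[symmetric]
    by (rule full_row_rank_injective)
  have so: "0 < z \<bullet> (hessian (Phi Q) a *v z)"
    if a: "accumulation_point u a" "a \<in> box_polyhedron ?A ?L ?U" "grad (Phi Q) a + transpose ?A *v l = 0"
      "sign_complementary ?A ?L ?U a l" and z: "z \<noteq> 0" "\<And>i. l $ i \<noteq> 0 \<Longrightarrow> (?A *v z) $ i = 0" for a l z
  proof -
    let ?S = "strongly_active Q a (xpart l) (pos_part (- xpart (ypart l))) (pos_part (xpart (ypart l)))
      (pos_part (- ypart (ypart l))) (pos_part (ypart (ypart l)))"
    have "(?A *v z) $ i = 0" if "i \<in> ?S" for i by (rule z(2)[OF strongly_active_nonzero[OF that]])
    then have "row_submatrix ?S ?A *v z = 0"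
      by (simp add: vec_eq_iff matrix_vector_mul_component row_submatrix_def)
    then show ?thesis
      using sosc[OF a(1) kkt[OF a(2-4)]] z(1) by (auto simp: strong_sosc_def sq_norm_def)
  qed
  have "\<exists>R K. (\<forall>k. R k \<subseteq> active_rows ?A ?L ?U (u k + d k)) \<and>
    (\<forall>\<epsilon>>0. \<forall>\<^sub>F k in sequentially. \<forall>x. \<bar>x \<bullet> ?v k\<bar> \<le> (\<epsilon> * norm x + K * (\<Sum>i\<in>R k. \<bar>(?A *v x) $ i\<bar>)) * norm (d k)) \<and>
    (\<forall>a l i k. accumulation_point u a \<longrightarrow> a \<in> box_polyhedron ?A ?L ?U \<longrightarrow> grad (Phi Q) a + transpose ?A *v l = 0 \<longrightarrow>
      sign_complementary ?A ?L ?U a l \<longrightarrow> R k \<noteq> {} \<longrightarrow> i \<in> active_rows ?A ?L ?U a \<longrightarrow> l $ i \<noteq> 0)"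
    using hess_approx
  proof
    assume small: "(\<lambda>k. norm (?v k)) \<in> o(\<lambda>k. norm (d k))"
    have "\<forall>\<^sub>F k in sequentially. \<forall>x. \<bar>x \<bullet> ?v k\<bar> \<le> \<epsilon> * norm x * norm (d k)" if "0 < \<epsilon>" for \<epsilon>
      using landau_o.smallD[OF small that]
    proof eventually_elim
      case (elim k)
      show ?case
      proof
        fix x
        have "\<bar>x \<bullet> ?v k\<bar> \<le> norm x * norm (?v k)" by (rule Cauchy_Schwarz_ineq2)
        also have "\<dots> \<le> norm x * (\<epsilon> * norm (d k))" using elim by (intro mult_left_mono) auto
        finally show "\<bar>x \<bullet> ?v k\<bar> \<le> \<epsilon> * norm x * norm (d k)" by (simp add: mult_ac)
      qed
    qed
    then show ?thesis by (intro exI[of _ "\<lambda>_. {}"] exI[of _ 0]) simp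
  next
    assume proj: "(\<lambda>k. norm (P k *v ?v k)) \<in> o(\<lambda>k. norm (d k)) \<and>
       (\<forall>a \<mu> \<alpha>x \<gamma>x \<alpha>y \<gamma>y. accumulation_point u a \<and> kkt Q a \<mu> \<alpha>x \<gamma>x \<alpha>y \<gamma>y \<longrightarrow>
          strict_complementarity Q a \<mu> \<alpha>x \<gamma>x \<alpha>y \<gamma>y)"
    define R where "R k = projection_rows (step2_accepts M M1 \<tau>1 (u k) (w1 k)) Q (u k) (w k)" for k
    have P: "P k = null_projection (R k) ?A" for k by (simp add: P_eq projection_matrix_eq R_def)
    obtain K where K: "0 \<le> K" "\<And>R x v. \<bar>x \<bullet> v\<bar> \<le>
        norm x * norm (null_projection R ?A *v v) + K * (\<Sum>i\<in>R. \<bar>(?A *v x) $ i\<bar>) * norm v"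
      using null_projection_bound[of ?A] by metis
    \<comment> \<open>The Hessian is known to be continuous only on \<open>W\<close>. Closedness of
      the polyhedron keeps the limits of iterates there, so the Hessian is bounded along the
      run.\<close>
    have "closure (range u) \<subseteq> W"
      using closure_minimal[OF _ closed_box_polyhedron, of "range u" ?A ?L ?U] feas W(2)
      by (auto simp: feasible_eq_box_polyhedron)
    then have "compact (hessian (Phi Q) ` closure (range u))"
      using u_bounded by (intro compact_continuous_image continuous_on_subset[OF hess_cont]) auto
    then obtain B1 where B1: "\<And>x. x \<in> closure (range u) \<Longrightarrow> norm (hessian (Phi Q) x) \<le> B1"
      by (meson bounded_iff compact_imp_bounded imageI)
    obtain B2 where B2: "\<And>k. norm (H k) \<le> B2" using Hb by (auto simp: bounded_iff)
    have vb: "norm (?v k) \<le> (B2 + B1) * norm (d k)" for k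
    proof -
      have "u k \<in> closure (range u)" by (meson closure_subset rangeI subsetD)
      then have "norm (H k - hessian (Phi Q) (u k)) \<le> B2 + B1"
        using norm_triangle_ineq4[of "H k" "hessian (Phi Q) (u k)"] B1[of "u k"] B2[of k] by linarith
      then show ?thesis by (intro order_trans[OF norm_matrix_vector_mult_le] mult_right_mono) auto
    qed
    \<comment> \<open>The norm of \<open>?v k\<close> multiplying the row term in
      \<open>K(2)\<close> is only O(|d_k|), which explains the new constant
      \<open>K * (B2 + B1)\<close>.\<close>
    have "\<forall>\<^sub>F k in sequentially. \<forall>x.
        \<bar>x \<bullet> ?v k\<bar> \<le> (\<epsilon> * norm x + (K * (B2 + B1)) * (\<Sum>i\<in>R k. \<bar>(?A *v x) $ i\<bar>)) * norm (d k)" if "0 < \<epsilon>" for \<epsilon>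
      using landau_o.smallD[OF conjunct1[OF proj] that]
    proof eventually_elim
      case (elim k)
      show ?case
      proof
        fix x
        let ?s = "\<Sum>i\<in>R k. \<bar>(?A *v x) $ i\<bar>"
        have "\<bar>x \<bullet> ?v k\<bar> \<le> norm x * norm (P k *v ?v k) + K * ?s * norm (?v k)"
          unfolding P by (rule K(2))
        also have "\<dots> \<le> norm x * (\<epsilon> * norm (d k)) + K * ?s * ((B2 + B1) * norm (d k))"
          using elim K(1) by (intro add_mono mult_left_mono vb) (auto simp: sum_nonneg)
        finally show "\<bar>x \<bullet> ?v k\<bar> \<le> (\<epsilon> * norm x + (K * (B2 + B1)) * ?s) * norm (d k)"
          by (simp add: algebra_simps)
      qed
    qed
    moreover have "R k \<subseteq> active_rows ?A ?L ?U (u k + d k)" for k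
      unfolding R_def d_eq direction_parts by (rule projection_rows_active)
    moreover have "l $ i \<noteq> 0"
      if "accumulation_point u a" "a \<in> box_polyhedron ?A ?L ?U" "grad (Phi Q) a + transpose ?A *v l = 0"
      "sign_complementary ?A ?L ?U a l" "i \<in> active_rows ?A ?L ?U a" for a l i
      using strict_complementarity_nonzero[OF _ that(5)] kkt[OF that(2-4)] proj that(1) by blast
    ultimately show ?thesis by blast
  qed
  then obtain R K where R: "\<And>k. R k \<subseteq> active_rows ?A ?L ?U (u k + d k)"
    and approx: "\<And>\<epsilon>. 0 < \<epsilon> \<Longrightarrow> \<forall>\<^sub>F k in sequentially. \<forall>x.
      \<bar>x \<bullet> ?v k\<bar> \<le> (\<epsilon> * norm x + K * (\<Sum>i\<in>R k. \<bar>(?A *v x) $ i\<bar>)) * norm (d k)"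
    and strict: "\<And>a l i k. accumulation_point u a \<Longrightarrow> a \<in> box_polyhedron ?A ?L ?U \<Longrightarrow>
      grad (Phi Q) a + transpose ?A *v l = 0 \<Longrightarrow> sign_complementary ?A ?L ?U a l \<Longrightarrow> R k \<noteq> {} \<Longrightarrow>
      i \<in> active_rows ?A ?L ?U a \<Longrightarrow> l $ i \<noteq> 0"
    by blast
  let ?C = "(norm (transpose (matE Q)) + norm (transpose (matF Q))) * M1"
  have stat: "norm (grad (Phi Q) (u k) + H k *v d k + transpose ?A *v signed_multiplier (w k))
      \<le> ?C * norm (d k) powr \<tau>1" for k
  proof -
    have "norm (grad (Phi Q) (u k) + H k *v d k + transpose ?A *v signed_multiplier (w k))
        \<le> (norm (transpose (matE Q)) + norm (transpose (matF Q))) * norm (muX (w k) - muY (w k))"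
      unfolding H_eq d_eq by (rule signed_multiplier_stationary[OF problem feas step])
    also have "\<dots> \<le> (norm (transpose (matE Q)) + norm (transpose (matF Q))) * (M1 * norm (d k) powr \<tau>1)"
      by (intro mult_left_mono gap) auto
    finally show ?thesis by (simp add: mult.assoc)
  qed
  interpret perturbed_sqp_run "Phi Q" "grad (Phi Q)" "hessian (Phi Q)" W ?A ?L ?U \<rho> \<sigma> \<eta> ?C \<tau>1 K u d H
    "\<lambda>k. signed_multiplier (w k)" t R
  proof
    show "(Phi Q has_derivative (\<lambda>h. grad (Phi Q) x \<bullet> h)) (at x)" for x
      using has_derivative_Phi[OF problem] by (simp add: grad_Phi[OF problem])
    show "u k \<in> box_polyhedron ?A ?L ?U" for k using feas by (simp add: feasible_eq_box_polyhedron)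
    show "u k + d k \<in> box_polyhedron ?A ?L ?U" for k
      using trial_properties(1)[OF feas step] by (simp add: d_eq flip: feasible_eq_box_polyhedron)
    show "sign_complementary ?A ?L ?U (u k + d k) (signed_multiplier (w k))" for k
      using signed_multiplier_complementary[OF feas step] by (simp add: d_eq)
    show "grad (Phi Q) (u k) \<bullet> d k + d k \<bullet> (H k *v d k)
        \<le> - (\<Sum>i\<in>UNIV. signed_multiplier (w k) $ i * (?A *v d k) $ i)" for k
      unfolding H_eq d_eq by (rule signed_multiplier_descent[OF problem feas step])
  qed (fact continuous_grad_Phi[OF problem] W deriv2 hess_cont params eta(1) u_bounded Hb coercive stat power
      armijo maximal upd lq so R approx strict)+
  show ?thesis by (rule superlinear_convergence)
qed

end
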